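(* Let $m\ge n\ge2$ be integers, let $\Lambda\subseteq\{0,\ldots,m-1\}\times\{0,\ldots,n-1\}$ be nonempty, and let $K\subseteq\mathbb{Z}^2$ be an invariant set of $\{S_{(i,j)}\}_{(i,j)\in\Lambda}$. Then $K$ is non-overlapping, and there is a set $P'$ with $\emptyset\ne P'\subseteq P(\Lambda)$ such that $$K=\bigcup_{z\in P'}\mathcal{O}^+_\Lambda(z).$$ Moreover, $$\mathrm{Dim}\,K=\max_{z\in P'}\mathrm{Dim}\,\mathcal{O}^+_\Lambda(z)$$ for each $\mathrm{Dim}\in\{\dim_{\mathrm{LH}},\dim_{\mathrm{DH}},\delta(\cdot),\dim_{\mathrm M},\dim_{\mathrm{DP}},\dim_{\mathrm{Be}},\dim_{\mathrm A}\}$.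
   Context: **Maps and orbits.** $S_{(i,j)}(x,y)=(mx+i,ny+j)$. For $(\mathbf i,\mathbf j)=(i_0\ldots i_{k-1},j_0\ldots j_{k-1})\in\Lambda^k$ (meaning $(i_\ell,j_\ell)\in\Lambda$ for all $\ell$), $S_{(\mathbf i,\mathbf j)}=S_{(i_0,j_0)}\circ\cdots\circ S_{(i_{k-1},j_{k-1})}$. The forward orbit $\mathcal{O}^+_\Lambda(z)$ of $z\in\mathbb{Z}^2$ is the set of all $S_{(\mathbf i,\mathbf j)}(z)$ with $(\mathbf i,\mathbf j)\in\Lambda^k$, $k\ge1$. Put $P(\Lambda)=\{z\in\mathbb{Z}^2:S_{(\mathbf i,\mathbf j)}(z)=z\text{ for some }(\mathbf i,\mathbf j)\in\Lambda^k,\ k\ge1\}$. A nonempty set $K$ is *invariant* if $K=\bigcup_{(i,j)\in\Lambda}S_{(i,j)}(K)$; it is *non-overlapping* if $S_{(i,j)}(K)\cap S_{(i',j')}(K)=\emptyset$ whenever $(i,j)\ne(i',j')$ in $\Lambda$. **Dimensions of $A\subseteq\mathbb{Z}^2$.** Mass: $\dim_{\mathrm{LM}}A$ and $\dim_{\mathrm{UM}}A$ are the $\liminf$ and $\limsup$ as $h\to+\infty$ of $\log\#(A\cap[-h,h]^2)/\log h$; if they agree, the common value is $\dim_{\mathrm M}A$ (the claim includes that it exists for $K$ and for the orbits). Beurling: $\dim_{\mathrm{Be}}A=\limsup_{h\to+\infty}\sup_{w\in\mathbb{R}^2}\dfrac{\log\#(A\cap(w+[-h,h]^2))}{\log h}$.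 Cubes: for $x\in\mathbb{Z}^2$ and $r\ge1$, $C(x,r)=\{y\in\mathbb{Z}^2:x_i\le y_i<x_i+r,\ i=1,2\}$ and $V(x,r)=\{y\in\mathbb{Z}^2:x_i-r/2\le y_i<x_i+r/2,\ i=1,2\}$; $\mathscr{C}=\{C(x,r):x\in\mathbb{Z}^2,\ r\in\mathbb{Z}_{>0}\}$. For a finite set $E\subset\mathbb{Z}^2$, $d(E)=\min\{r\in\mathbb{Z}_{>0}:E\subseteq C(x,r)\text{ for some }x\in\mathbb{Z}^2\}$. Put $V_k^{(2)}=V(0,2^k)$ for $k\ge0$, $S_1^{(2)}=V_1^{(2)}$, $S_k^{(2)}=V_k^{(2)}\setminus V_{k-1}^{(2)}$ for $k\ge2$. For $F\subset\mathbb{Z}^2$ finite and nonempty and $\alpha>0$, $$\nu_\alpha(A,F)=\min\Big\{\sum_i\Big(\frac{d(U_i)}{d(F)}\Big)^\alpha:U_i\in\mathscr{C},\ A\cap F\subseteq\bigcup_iU_i\Big\}.$$ Discrete Hausdorff: $\dim_{\mathrm{DH}}A=\inf\{\alpha>0:\sum_{k\ge1}\nu_\alpha(A,S_k^{(2)})<\infty\}$. Lower discrete Hausdorff: $\dim_{\mathrm{LH}}A=\inf\{\alpha>0:\lim_{k\to\infty}\nu_\alpha(A,S_k^{(2)})=0\}$. For $r\ge1$, $N_r(A)$ is the minimum number of axis-parallel squares of side length $r$ needed to cover $A$, and $P_r(A)$ is the maximum cardinality of a family of pairwise disjoint axis-parallel squares of side length $r$ centered at points of $A$. (Scales $r$ may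 be taken real, in which case maxima/minima over $r$ mean suprema/infima, or integer; this does not affect the dimensions.) Discrete packing: $\dim_{\mathrm{DP}}A=\inf\{\alpha\ge0:\lim_{k\to\infty}\max_{1\le r\le2^{k(1-\varepsilon)}}(r/2^k)^\alpha P_r(A\cap S_k^{(2)})=0\text{ for each }\varepsilon\in(0,1)\}$. Lower entropy index: $\delta(A)=\inf\{\alpha\ge0:\lim_{k\to\infty}\min_{1\le r\le2^{k(1-\varepsilon)}}(r/2^k)^\alpha P_r(A\cap S_k^{(2)})=0\text{ for some }\varepsilon\in(0,1)\}$. Assouad (large-scale): $\dim_{\mathrm A}A=\inf\{\alpha\ge0:\exists C>0\text{ with }N_r(A\cap B(x,R))\le C(R/r)^\alpha\text{ for all }x\in A,\ 1\le r<R\}$, where $B(x,R)$ is the Euclidean ball. *)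

theory Defs
  imports "HOL-Analysis.Analysis"
begin

text \<open>Maps, orbits and invariant sets\<close>

definition affine_map :: "int \<Rightarrow> int \<Rightarrow> int \<times> int \<Rightarrow> int \<times> int \<Rightarrow> int \<times> int" where
  "affine_map m n d z = (m * fst z + fst d, n * snd z + snd d)"

definition word_map :: "int \<Rightarrow> int \<Rightarrow> (int \<times> int) list \<Rightarrow> int \<times> int \<Rightarrow> int \<times> int" where
  "word_map m n ds = foldr (\<lambda>d f. affine_map m n d \<circ> f) ds id"

definition forward_orbit :: "int \<Rightarrow> int \<Rightarrow> (int \<times> int) set \<Rightarrow> int \<times> int \<Rightarrow> (int \<times> int) set" where
  "forward_orbit m n \<Lambda> z = {word_map m n ds z | ds. ds \<in> lists \<Lambda> \<and> length ds \<ge> 1}"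

definition periodic_points :: "int \<Rightarrow> int \<Rightarrow> (int \<times> int) set \<Rightarrow> (int \<times> int) set" where
  "periodic_points m n \<Lambda> = {z. \<exists>ds. ds \<in> lists \<Lambda> \<and> length ds \<ge> 1 \<and> word_map m n ds z = z}"

definition invariant_set :: "int \<Rightarrow> int \<Rightarrow> (int \<times> int) set \<Rightarrow> (int \<times> int) set \<Rightarrow> bool" where
  "invariant_set m n \<Lambda> K \<longleftrightarrow> K \<noteq> {} \<and> K = (\<Union>d\<in>\<Lambda>. affine_map m n d ` K)"

definition non_overlapping :: "int \<Rightarrow> int \<Rightarrow> (int \<times> int) set \<Rightarrow> (int \<times> int) set \<Rightarrow> bool" where
  "non_overlapping m n \<Lambda> K \<longleftrightarrow>
     (\<forall>d\<in>\<Lambda>. \<forall>d'\<in>\<Lambda>. d \<noteq> d' \<longrightarrow> affine_map m n d ` K \<inter> affine_map m n d' ` K = {})"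

text \<open>Mass and Beurling dimensions.
  All dimensions take values in the extended reals, so that they are meaningful for every set.\<close>

definition emb :: "int \<times> int \<Rightarrow> real \<times> real" where
  "emb z = (real_of_int (fst z), real_of_int (snd z))"

definition elog :: "nat \<Rightarrow> ereal" where
  "elog N = (if N = 0 then -\<infinity> else ereal (ln (real N)))"

definition window_count :: "(int \<times> int) set \<Rightarrow> real \<times> real \<Rightarrow> real \<Rightarrow> nat" where
  "window_count A w h = card {a \<in> A. emb a - w \<in> {-h..h} \<times> {-h..h}}"

definition dim_LM :: "(int \<times> int) set \<Rightarrow> ereal" where
  "dim_LM A = Liminf at_top (\<lambda>h::real. elog (window_count A 0 h) / ereal (ln h))"

definition dim_UM :: "(int \<times> int) set \<Rightarrow> ereal" where
  "dim_UM A = Limsup at_top (\<lambda>h::real. elog (window_count A 0 h) / ereal (ln h))"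

definition dim_M :: "(int \<times> int) set \<Rightarrow> ereal" where
  "dim_M A = (if dim_LM A = dim_UM A then dim_LM A else undefined)"

definition dim_Be :: "(int \<times> int) set \<Rightarrow> ereal" where
  "dim_Be A = Limsup at_top (\<lambda>h::real. SUP w. elog (window_count A w h) / ereal (ln h))"

text \<open>Discrete Hausdorff dimensions\<close>

definition cube :: "int \<times> int \<Rightarrow> nat \<Rightarrow> (int \<times> int) set" where
  "cube x r = {y. fst x \<le> fst y \<and> fst y < fst x + int r \<and>
                  snd x \<le> snd y \<and> snd y < snd x + int r}"

definition cubes :: "(int \<times> int) set set" where
  "cubes = {cube x r | x r. r > 0}"

definition centered_cube :: "int \<times> int \<Rightarrow> real \<Rightarrow> (int \<times> int) set" where
  "centered_cube x r = {y.
     real_of_int (fst x) - r / 2 \<le> real_of_int (fst y) \<and>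
     real_of_int (fst y) < real_of_int (fst x) + r / 2 \<and>
     real_of_int (snd x) - r / 2 \<le> real_of_int (snd y) \<and>
     real_of_int (snd y) < real_of_int (snd x) + r / 2}"

definition cube_diam :: "(int \<times> int) set \<Rightarrow> nat" where
  "cube_diam E = (LEAST r. r > 0 \<and> (\<exists>x. E \<subseteq> cube x r))"

text \<open>Only the shells with index at least 1 are used.\<close>

definition shell :: "nat \<Rightarrow> (int \<times> int) set" where
  "shell k = (if k = 1 then centered_cube 0 (2 ^ 1)
              else centered_cube 0 (2 ^ k) - centered_cube 0 (2 ^ (k - 1)))"

text \<open>Finite covers suffice in the next definition: for finite \<open>F\<close> and positive \<open>\<alpha>\<close> every
  cube contributes at least \<open>(1 / cube_diam F) powr \<alpha>\<close>, so an infinite family has infinite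
  sum. For the same reason the infimum is attained.\<close>

definition nu :: "real \<Rightarrow> (int \<times> int) set \<Rightarrow> (int \<times> int) set \<Rightarrow> real" where
  "nu \<alpha> A F = Inf {\<Sum>U\<in>\<U>. (real (cube_diam U) / real (cube_diam F)) powr \<alpha> | \<U>.
                     finite \<U> \<and> \<U> \<subseteq> cubes \<and> A \<inter> F \<subseteq> \<Union>\<U>}"

definition dim_DH :: "(int \<times> int) set \<Rightarrow> ereal" where
  "dim_DH A = Inf (ereal ` {\<alpha>. \<alpha> > 0 \<and> summable (\<lambda>k. nu \<alpha> A (shell (Suc k)))})"

definition dim_LH :: "(int \<times> int) set \<Rightarrow> ereal" where
  "dim_LH A = Inf (ereal ` {\<alpha>. \<alpha> > 0 \<and> (\<lambda>k. nu \<alpha> A (shell k)) \<longlonglongrightarrow> 0})"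

text \<open>Packing, entropy and Assouad dimensions. Squares are closed squares in the plane, and
  scales are real. \<open>cover_number\<close> is applied to bounded sets and \<open>packing_number\<close> to
  finite sets only, so that the minimum and the maximum exist.\<close>

definition square :: "real \<Rightarrow> real \<times> real \<Rightarrow> (real \<times> real) set" where
  "square r c = {fst c - r / 2 .. fst c + r / 2} \<times> {snd c - r / 2 .. snd c + r / 2}"

definition cover_number :: "real \<Rightarrow> (int \<times> int) set \<Rightarrow> nat" where
  "cover_number r A = (LEAST N. \<exists>T. finite T \<and> card T = N \<and> emb ` A \<subseteq> (\<Union>c\<in>T. square r c))"

definition packing_number :: "real \<Rightarrow> (int \<times> int) set \<Rightarrow> nat" where
  "packing_number r A = Max {card T | T. T \<subseteq> A \<and> disjoint_family_on (\<lambda>a. square r (emb a)) T}"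

definition packing_term :: "real \<Rightarrow> (int \<times> int) set \<Rightarrow> nat \<Rightarrow> real \<Rightarrow> real" where
  "packing_term \<alpha> A k r = (r / 2 ^ k) powr \<alpha> * real (packing_number r (A \<inter> shell k))"

definition dim_DP :: "(int \<times> int) set \<Rightarrow> ereal" where
  "dim_DP A = Inf (ereal ` {\<alpha>. \<alpha> \<ge> 0 \<and> (\<forall>\<epsilon>\<in>{0<..<1}.
     (\<lambda>k. SUP r\<in>{1..2 powr (real k * (1 - \<epsilon>))}. packing_term \<alpha> A k r) \<longlonglongrightarrow> 0)})"

definition lower_entropy_index :: "(int \<times> int) set \<Rightarrow> ereal" where
  "lower_entropy_index A = Inf (ereal ` {\<alpha>. \<alpha> \<ge> 0 \<and> (\<exists>\<epsilon>\<in>{0<..<1}.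
     (\<lambda>k. INF r\<in>{1..2 powr (real k * (1 - \<epsilon>))}. packing_term \<alpha> A k r) \<longlonglongrightarrow> 0)})"

text \<open>The metric on \<open>real \<times> real\<close> is the Euclidean one.\<close>

definition dim_A :: "(int \<times> int) set \<Rightarrow> ereal" where
  "dim_A A = Inf (ereal ` {\<alpha>. \<alpha> \<ge> 0 \<and> (\<exists>C>0. \<forall>x\<in>A. \<forall>r R. 1 \<le> r \<and> r < R \<longrightarrow>
     real (cover_number r {a \<in> A. emb a \<in> ball (emb x) R}) \<le> C * (R / r) powr \<alpha>)})"

end

theory Submission
  imports Defs
begin

text \<open>Every point of \<open>K\<close> has a unique digit expansion: the inverse branches are division by
  \<open>(m, n)\<close>, and iterating them ends in \<open>{-1, 0} \<times> {-1, 0}\<close>. Hence \<open>K\<close> is the union of the orbits of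
  \<open>P' = K \<inter> ({-1, 0} \<times> {-1, 0})\<close>, all of whose points are fixed by a map of the system.

  Most of the dimensions are finitely stable, and the mass dimension of an orbit exists by counting
  digit words, so that for these the maximum formula is immediate. The lower entropy index is not
  finitely stable. Up to a bounded factor, packing numbers count the cells
  \<open>(x div m ^ a, y div n ^ b)\<close>. In a large square the orbit of a corner \<open>z\<close> is a block of digit
  words whose leading letters come from the column of \<open>\<Lambda>\<close> over the first digit of \<open>z\<close>, so its
  cell counts depend monotonically on the size of that column. The corner with the largest column
  therefore dominates at all scales simultaneously, once its block is translated into a single
  shell.\<close>

section \<open>Finite stability\<close>

text \<open>The obstacle is \<open>lower_entropy_index\<close>. Its terms are minima over the scale,
  and two sets may be sparse at different scales, so the minimum for a union is not controlled by
  the two separate minima. One orbit has to dominate the others at every scale at once, which calls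
  for exact counting. Columns enter because a square of side h holds about
  \<open>ln h / ln m\<close> digits horizontally but \<open>ln h / ln n\<close> vertically: once the
  horizontal digits are used up, each remaining letter must keep the first coordinate fixed. A
  second difficulty is that the index sees one shell at a time, whereas a block at the origin meets
  many shells and its part in a given shell need not have a product structure. Whole blocks are
  therefore moved outward by a prefix. This changes the shell index by a bounded amount only, which
  the freedom in the choice of \<epsilon> absorbs. A prefix that leaves the first coordinate alone
  exists when the largest column has two letters; otherwise the prefix is borrowed from another
  corner.\<close>

lemma Inf_Int_up_closed:
  fixes S T :: "real set"
  assumes S: "\<And>a b. a \<in> S \<Longrightarrow> a \<le> b \<Longrightarrow> b \<in> S"
    and T: "\<And>a b. a \<in> T \<Longrightarrow> a \<le> b \<Longrightarrow> b \<in> T"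
  shows "Inf (ereal ` (S \<inter> T)) = max (Inf (ereal ` S)) (Inf (ereal ` T))"
proof -
  \<comment> \<open>Up-closed sets of reals are nested, so the intersection is one of the two. In
    the applications S and T are the admissible exponents of A and B, and those of the union form
    the intersection.\<close>
  consider "S \<subseteq> T" | "T \<subseteq> S"
    by (metis S T linorder_le_cases subsetI)
  then show ?thesis
  proof cases
    case 1
    then have "Inf (ereal ` T) \<le> Inf (ereal ` S)"
      by (intro Inf_superset_mono image_mono)
    with 1 show ?thesis by (simp add: max_absorb1 Int_absorb2)
  next
    case 2
    then have "Inf (ereal ` S) \<le> Inf (ereal ` T)"
      by (intro Inf_superset_mono image_mono)
    with 2 show ?thesis by (simp add: max_absorb2 Int_absorb1)
  qed
qed

lemma Max_image_finite_union:
  fixes Dim :: "'a set \<Rightarrow> 'b::linorder"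
  assumes Un: "\<And>A B. Dim (A \<union> B) = max (Dim A) (Dim B)" and "finite I" "I \<noteq> {}"
  shows "Dim (\<Union>i\<in>I. X i) = (MAX i\<in>I. Dim (X i))"
  using \<open>finite I\<close> \<open>I \<noteq> {}\<close>
  by (induction I rule: finite_ne_induct) (auto simp: Un)

section \<open>Covering sums and the discrete Hausdorff dimensions\<close>

lemma finite_cube: "finite (cube x r)"
proof -
  have "cube x r \<subseteq> {fst x..fst x + int r} \<times> {snd x..snd x + int r}"
    by (auto simp: cube_def)
  then show ?thesis by (rule finite_subset) auto
qed

lemma centered_cube_subset_cube:
  "centered_cube 0 (2 ^ k) \<subseteq> cube (- (2 ^ k), - (2 ^ k)) (2 ^ Suc k)"
proof
  fix y assume "y \<in> centered_cube 0 (2 ^ k)"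
  moreover have "real_of_int a \<ge> - (2 ^ k / 2) \<Longrightarrow> a \<ge> - (2 ^ k)" "real_of_int a < 2 ^ k / 2 \<Longrightarrow> a < 2 ^ k" for a
  proof -
    have pos: "(0::real) < 2 ^ k" by simp
    show "a \<ge> - (2 ^ k)" if "real_of_int a \<ge> - (2 ^ k / 2)"
    proof -
      have "real_of_int (- (2 ^ k)) \<le> real_of_int a" using that pos unfolding of_int_minus of_int_power of_int_numeral by linarith
      then show ?thesis unfolding of_int_le_iff .
    qed
    show "a < 2 ^ k" if "real_of_int a < 2 ^ k / 2"
    proof -
      have "real_of_int a < real_of_int (2 ^ k)" using that pos unfolding of_int_power of_int_numeral by linarith
      then show ?thesis unfolding of_int_less_iff .
    qed
  qed
  ultimately show "y \<in> cube (- (2 ^ k), - (2 ^ k)) (2 ^ Suc k)"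
    by (simp add: centered_cube_def cube_def)
qed

lemma shell_subset_cube: "\<exists>x r. r > 0 \<and> shell k \<subseteq> cube x r"
proof -
  have "shell k \<subseteq> centered_cube 0 (2 ^ k)" by (auto simp: shell_def)
  with centered_cube_subset_cube[of k] show ?thesis
    by (meson order_trans zero_less_numeral zero_less_power)
qed

lemma finite_shell: "finite (shell k)"
  using shell_subset_cube[of k] finite_cube finite_subset by blast

lemma cube_diam_spec:
  assumes "r > 0" "E \<subseteq> cube x r"
  shows "cube_diam E > 0" "\<exists>x. E \<subseteq> cube x (cube_diam E)" "cube_diam E \<le> r"
proof -
  have ex: "r > 0 \<and> (\<exists>x. E \<subseteq> cube x r)" using assms by blast
  show "cube_diam E > 0" "\<exists>x. E \<subseteq> cube x (cube_diam E)"
    using LeastI[where P = "\<lambda>r. r > 0 \<and> (\<exists>x. E \<subseteq> cube x r)", OF ex]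
    by (auto simp: cube_diam_def)
  show "cube_diam E \<le> r"
    unfolding cube_diam_def by (rule Least_le) (rule ex)
qed

definition cover_sums :: "real \<Rightarrow> (int \<times> int) set \<Rightarrow> (int \<times> int) set \<Rightarrow> real set" where
  "cover_sums \<alpha> A F = {\<Sum>U\<in>\<U>. (real (cube_diam U) / real (cube_diam F)) powr \<alpha> | \<U>.
                     finite \<U> \<and> \<U> \<subseteq> cubes \<and> A \<inter> F \<subseteq> \<Union>\<U>}"

lemma nu_eq: "nu \<alpha> A F = Inf (cover_sums \<alpha> A F)"
  by (simp add: nu_def cover_sums_def)

lemma cover_sums_nonneg: "s \<in> cover_sums \<alpha> A F \<Longrightarrow> s \<ge> 0"
  by (auto simp: cover_sums_def intro!: sum_nonneg)

lemma bdd_below_cover_sums: "bdd_below (cover_sums \<alpha> A F)"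
  by (rule bdd_belowI[where m = 0]) (rule cover_sums_nonneg)

text \<open>One cube of the diameter of the shell covers it. This makes the set of sums nonempty for
  every exponent, so that the real \<open>Inf\<close> is meaningful, and bounds the infimum by 1 for
  nonnegative exponents.\<close>

lemma unit_cover_sum:
  "\<exists>s \<in> cover_sums \<alpha> A (shell k). \<alpha> \<ge> 0 \<longrightarrow> s \<le> 1"
proof -
  obtain x0 r0 where r0: "r0 > 0" "shell k \<subseteq> cube x0 r0" using shell_subset_cube by blast
  let ?r = "cube_diam (shell k)"
  obtain x where x: "shell k \<subseteq> cube x ?r" and pos: "?r > 0"
    using cube_diam_spec[OF r0] by blast
  have le: "cube_diam (cube x ?r) \<le> ?r"
    using cube_diam_spec(3)[OF pos order_refl] .
  have "(\<Sum>U\<in>{cube x ?r}. (real (cube_diam U) / real ?r) powr \<alpha>) \<in> cover_sums \<alpha> A (shell k)"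
    unfolding cover_sums_def cubes_def using x pos
    by (intro CollectI exI[of _ "{cube x ?r}"]) blast
  moreover have "\<alpha> \<ge> 0 \<longrightarrow> (\<Sum>U\<in>{cube x ?r}. (real (cube_diam U) / real ?r) powr \<alpha>) \<le> 1"
    using le pos by (auto intro!: powr_le1)
  ultimately show ?thesis by blast
qed

lemma cover_sums_ne: "cover_sums \<alpha> A (shell k) \<noteq> {}"
  using unit_cover_sum by blast

lemma nu_nonneg: "nu \<alpha> A (shell k) \<ge> 0"
  unfolding nu_eq using cover_sums_ne cover_sums_nonneg by (intro cInf_greatest) auto

lemma nu_mono: "A \<subseteq> B \<Longrightarrow> nu \<alpha> A (shell k) \<le> nu \<alpha> B (shell k)"
  unfolding nu_eq
  by (intro cInf_superset_mono cover_sums_ne bdd_below_cover_sums) (unfold cover_sums_def, blast)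

lemma nu_Un: "nu \<alpha> (A \<union> B) (shell k) \<le> nu \<alpha> A (shell k) + nu \<alpha> B (shell k)"
proof -
  have "nu \<alpha> (A \<union> B) (shell k) \<le> s + t"
    if s: "s \<in> cover_sums \<alpha> A (shell k)" and t: "t \<in> cover_sums \<alpha> B (shell k)" for s t
  proof -
    let ?f = "\<lambda>U. (real (cube_diam U) / real (cube_diam (shell k))) powr \<alpha>"
    obtain U where U: "s = sum ?f U" "finite U" "U \<subseteq> cubes" "A \<inter> shell k \<subseteq> \<Union>U"
      using s unfolding cover_sums_def by blast
    obtain V where V: "t = sum ?f V" "finite V" "V \<subseteq> cubes" "B \<inter> shell k \<subseteq> \<Union>V"
      using t unfolding cover_sums_def by blast
    have "sum ?f (U \<union> V) \<in> cover_sums \<alpha> (A \<union> B) (shell k)"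
      unfolding cover_sums_def using U V by (intro CollectI exI[of _ "U \<union> V"]) auto
    then have "nu \<alpha> (A \<union> B) (shell k) \<le> sum ?f (U \<union> V)"
      unfolding nu_eq by (intro cInf_lower bdd_below_cover_sums)
    also have "\<dots> \<le> sum ?f U + sum ?f V"
      using sum.union_inter[OF U(2) V(2), of ?f] sum_nonneg[of "U \<inter> V" ?f] by simp
    finally show ?thesis using U V by simp
  qed
  then have "nu \<alpha> (A \<union> B) (shell k) - t \<le> nu \<alpha> A (shell k)"
    if "t \<in> cover_sums \<alpha> B (shell k)" for t
    unfolding nu_eq[of \<alpha> A] using that
    by (intro cInf_greatest cover_sums_ne) (simp add: algebra_simps)
  then have "nu \<alpha> (A \<union> B) (shell k) - nu \<alpha> A (shell k) \<le> nu \<alpha> B (shell k)"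
    unfolding nu_eq[of \<alpha> B]
    by (intro cInf_greatest cover_sums_ne) (simp add: algebra_simps)
  then show ?thesis by simp
qed

text \<open>Raising the exponent lowers a summand only if its ratio of diameters is at most 1. A
  cover that uses a larger cube already has sum at least 1, and the cover by a single cube does no
  worse.\<close>

lemma nu_antimono_exponent:
  assumes "0 \<le> \<alpha>" "\<alpha> \<le> \<beta>"
  shows "nu \<beta> A (shell k) \<le> nu \<alpha> A (shell k)"
  unfolding nu_eq[of \<alpha>]
proof (rule cInf_greatest[OF cover_sums_ne])
  fix s assume "s \<in> cover_sums \<alpha> A (shell k)"
  let ?f = "\<lambda>\<alpha> U. (real (cube_diam U) / real (cube_diam (shell k))) powr \<alpha>"
  obtain U where U: "s = sum (?f \<alpha>) U" "finite U" "U \<subseteq> cubes" "A \<inter> shell k \<subseteq> \<Union>U"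
    using \<open>s \<in> _\<close> unfolding cover_sums_def by blast
  have pos: "cube_diam (shell k) > 0"
    using cube_diam_spec(1) shell_subset_cube by blast
  show "nu \<beta> A (shell k) \<le> s"
  proof (cases "\<forall>V\<in>U. cube_diam V \<le> cube_diam (shell k)")
    case True
    have "nu \<beta> A (shell k) \<le> sum (?f \<beta>) U"
      unfolding nu_eq using U by (intro cInf_lower bdd_below_cover_sums) (unfold cover_sums_def, blast)
    also have "\<dots> \<le> s"
      unfolding U(1) using True pos assms by (intro sum_mono powr_mono') auto
    finally show ?thesis .
  next
    case False
    then obtain V where V: "V \<in> U" "cube_diam V > cube_diam (shell k)" by force
    obtain t where t: "t \<in> cover_sums \<beta> A (shell k)" "t \<le> 1"
      using unit_cover_sum[of \<beta>] assms by force
    have "nu \<beta> A (shell k) \<le> t"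
      unfolding nu_eq using t by (intro cInf_lower bdd_below_cover_sums)
    also have "t \<le> 1" by fact
    also have "1 \<le> ?f \<alpha> V" using V pos assms by (intro ge_one_powr_ge_zero) auto
    also have "\<dots> \<le> s" unfolding U(1) using V U by (intro member_le_sum) auto
    finally show ?thesis .
  qed
qed

lemma dim_LH_Un: "dim_LH (A \<union> B) = max (dim_LH A) (dim_LH B)"
proof -
  let ?S = "\<lambda>A. {\<alpha>. \<alpha> > 0 \<and> (\<lambda>k. nu \<alpha> A (shell k)) \<longlonglongrightarrow> 0}"
  have null_mono: "(\<lambda>k. nu \<alpha> A (shell k)) \<longlonglongrightarrow> 0"
    if "g \<longlonglongrightarrow> 0" "\<And>k. nu \<alpha> A (shell k) \<le> g k" for \<alpha> A g
    using that by (intro tendsto_sandwich[OF _ _ tendsto_const that(1)]) (auto simp: nu_nonneg)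
  have "?S (A \<union> B) = ?S A \<inter> ?S B"
  proof (intro equalityI subsetI)
    fix \<alpha> assume \<alpha>: "\<alpha> \<in> ?S (A \<union> B)"
    then have lim: "(\<lambda>k. nu \<alpha> (A \<union> B) (shell k)) \<longlonglongrightarrow> 0" by simp
    show "\<alpha> \<in> ?S A \<inter> ?S B"
      using \<alpha> null_mono[OF lim nu_mono[OF Un_upper1]] null_mono[OF lim nu_mono[OF Un_upper2]]
      by simp
  next
    fix \<alpha> assume \<alpha>: "\<alpha> \<in> ?S A \<inter> ?S B"
    show "\<alpha> \<in> ?S (A \<union> B)"
      using \<alpha> null_mono[OF tendsto_add_zero nu_Un, of \<alpha> A B] by simp
  qed
  moreover have "b \<in> ?S A" if "a \<in> ?S A" "a \<le> b" for a b A
    using that null_mono[OF _ nu_antimono_exponent[of a b A]] by simp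
  ultimately show ?thesis
    unfolding dim_LH_def by (simp only:) (intro Inf_Int_up_closed)
qed

lemma dim_DH_Un: "dim_DH (A \<union> B) = max (dim_DH A) (dim_DH B)"
proof -
  let ?S = "\<lambda>A. {\<alpha>. \<alpha> > 0 \<and> summable (\<lambda>k. nu \<alpha> A (shell (Suc k)))}"
  have sum_mono: "summable (\<lambda>k. nu \<alpha> A (shell (Suc k)))"
    if "summable g" "\<And>k. nu \<alpha> A (shell (Suc k)) \<le> g k" for \<alpha> A g
    using that by (intro summable_comparison_test[OF _ that(1)]) (auto simp: nu_nonneg)
  have "?S (A \<union> B) = ?S A \<inter> ?S B"
  proof (intro equalityI subsetI)
    fix \<alpha> assume \<alpha>: "\<alpha> \<in> ?S (A \<union> B)"
    then have "summable (\<lambda>k. nu \<alpha> (A \<union> B) (shell (Suc k)))" by simp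
    then show "\<alpha> \<in> ?S A \<inter> ?S B"
      using \<alpha> sum_mono[OF _ nu_mono[OF Un_upper1]] sum_mono[OF _ nu_mono[OF Un_upper2]]
      by simp
  next
    fix \<alpha> assume \<alpha>: "\<alpha> \<in> ?S A \<inter> ?S B"
    show "\<alpha> \<in> ?S (A \<union> B)"
      using \<alpha> sum_mono[OF summable_add nu_Un, of \<alpha> A B] by simp
  qed
  moreover have "b \<in> ?S A" if "a \<in> ?S A" "a \<le> b" for a b A
    using that sum_mono[OF _ nu_antimono_exponent[of a b A]] by simp
  ultimately show ?thesis
    unfolding dim_DH_def by (simp only:) (intro Inf_Int_up_closed)
qed

section \<open>Packing numbers and the discrete packing dimension\<close>

lemma packing_number_set_props:
  assumes "finite A"
  shows "finite {card T | T. T \<subseteq> A \<and> disjoint_family_on (\<lambda>a. square r (emb a)) T}"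
    "{card T | T. T \<subseteq> A \<and> disjoint_family_on (\<lambda>a. square r (emb a)) T} \<noteq> {}"
proof -
  show "finite {card T | T. T \<subseteq> A \<and> disjoint_family_on (\<lambda>a. square r (emb a)) T}"
    using assms by simp
  have "disjoint_family_on (\<lambda>a. square r (emb a)) {}" by (simp add: disjoint_family_on_def)
  then show "{card T | T. T \<subseteq> A \<and> disjoint_family_on (\<lambda>a. square r (emb a)) T} \<noteq> {}"
    by blast
qed

lemma packing_number_ge:
  assumes "finite A" "T \<subseteq> A" "disjoint_family_on (\<lambda>a. square r (emb a)) T"
  shows "card T \<le> packing_number r A"
  unfolding packing_number_def using assms packing_number_set_props[OF assms(1)]
  by (intro Max_ge) auto

lemma packing_number_attained:
  assumes "finite A"
  obtains T where "T \<subseteq> A" "disjoint_family_on (\<lambda>a. square r (emb a)) T"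
    "packing_number r A = card T"
  using Max_in[OF packing_number_set_props[OF assms, of r]]
  unfolding packing_number_def[symmetric] by auto

lemma packing_number_mono:
  assumes "finite B" "A \<subseteq> B"
  shows "packing_number r A \<le> packing_number r B"
  by (metis assms finite_subset order_trans packing_number_attained packing_number_ge)

lemma packing_number_le_card: "finite A \<Longrightarrow> packing_number r A \<le> card A"
  by (metis card_mono packing_number_attained)

lemma packing_number_Un:
  assumes "finite A" "finite B"
  shows "packing_number r (A \<union> B) \<le> packing_number r A + packing_number r B"
proof -
  have "finite (A \<union> B)" using assms by simp
  then obtain T where T: "T \<subseteq> A \<union> B" "disjoint_family_on (\<lambda>a. square r (emb a)) T"
    "packing_number r (A \<union> B) = card T"
    by (rule packing_number_attained)
  have "T = (T \<inter> A) \<union> (T \<inter> B)" using T by blast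
  then have "card T \<le> card (T \<inter> A) + card (T \<inter> B)" by (metis card_Un_le)
  also have "\<dots> \<le> packing_number r A + packing_number r B"
    using T(2) assms
    by (intro add_mono packing_number_ge) (auto intro: disjoint_family_on_mono[rotated])
  finally show ?thesis using T by simp
qed

lemma packing_term_nonneg: "packing_term \<alpha> A k r \<ge> 0"
  by (simp add: packing_term_def)

lemma packing_term_mono: "A \<subseteq> B \<Longrightarrow> packing_term \<alpha> A k r \<le> packing_term \<alpha> B k r"
  unfolding packing_term_def
  by (intro mult_left_mono) (auto intro!: packing_number_mono finite_Int finite_shell)

lemma packing_term_Un:
  "packing_term \<alpha> (A \<union> B) k r \<le> packing_term \<alpha> A k r + packing_term \<alpha> B k r"
proof -
  have "packing_number r ((A \<union> B) \<inter> shell k)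
      \<le> packing_number r (A \<inter> shell k) + packing_number r (B \<inter> shell k)"
    unfolding Int_Un_distrib2 by (intro packing_number_Un finite_Int disjI2 finite_shell)
  then show ?thesis
    unfolding packing_term_def distrib_left[symmetric] of_nat_add[symmetric]
    by (intro mult_left_mono) auto
qed

lemma packing_term_antimono_exponent:
  assumes "1 \<le> r" "r \<le> 2 ^ k" "\<alpha> \<le> \<beta>"
  shows "packing_term \<beta> A k r \<le> packing_term \<alpha> A k r"
  unfolding packing_term_def using assms by (intro mult_right_mono powr_mono') auto

lemma scale_le:
  assumes "\<epsilon> \<in> {0<..<1}" "r \<le> 2 powr (real k * (1 - \<epsilon>))"
  shows "r \<le> 2 ^ k"
proof -
  have "2 powr (real k * (1 - \<epsilon>)) \<le> 2 powr real k"
    using assms by (intro powr_mono) (auto simp: mult_left_le)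
  with assms show ?thesis by (simp add: powr_realpow)
qed

lemma one_le_scale: "\<epsilon> \<in> {0<..<1} \<Longrightarrow> 1 \<le> 2 powr (real k * (1 - \<epsilon>))"
  by (intro ge_one_powr_ge_zero) auto

text \<open>The supremum over scales is taken in the reals, so every comparison of suprema relies on
  this bound: the base \<open>r / 2 ^ k\<close> is at most 1, and a packing has no more centres than
  the shell has points.\<close>

lemma bdd_above_packing_term:
  assumes "\<epsilon> \<in> {0<..<1}" "\<alpha> \<ge> 0"
  shows "bdd_above (packing_term \<alpha> A k ` {1..2 powr (real k * (1 - \<epsilon>))})"
proof (rule bdd_aboveI2)
  fix r assume r: "r \<in> {1..2 powr (real k * (1 - \<epsilon>))}"
  then have "(r / 2 ^ k) powr \<alpha> \<le> 1"
    using scale_le[OF assms(1), of r k] assms by (intro powr_le1) auto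
  moreover have "packing_number r (A \<inter> shell k) \<le> card (A \<inter> shell k)"
    by (intro packing_number_le_card finite_Int disjI2 finite_shell)
  ultimately show "packing_term \<alpha> A k r \<le> 1 * real (card (A \<inter> shell k))"
    unfolding packing_term_def by (intro mult_mono) auto
qed

text \<open>The supremum over scales is subadditive in the set, and both sets are tested with the
  same \<epsilon>.\<close>

lemma dim_DP_Un: "dim_DP (A \<union> B) = max (dim_DP A) (dim_DP B)"
proof -
  let ?I = "\<lambda>\<epsilon> k. {1..2 powr (real k * (1 - \<epsilon>))}"
  let ?g = "\<lambda>\<alpha> A \<epsilon> k. SUP r\<in>?I \<epsilon> k. packing_term \<alpha> A k r"
  let ?S = "\<lambda>A. {\<alpha>. \<alpha> \<ge> 0 \<and> (\<forall>\<epsilon>\<in>{0<..<1}. ?g \<alpha> A \<epsilon> \<longlonglongrightarrow> 0)}"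
  have ne: "?I \<epsilon> k \<noteq> {}" if "\<epsilon> \<in> {0<..<1}" for \<epsilon> k
    using one_le_scale[OF that, of k] by simp
  have nonneg: "?g \<alpha> A \<epsilon> k \<ge> 0" if "\<epsilon> \<in> {0<..<1}" "\<alpha> \<ge> 0" for \<alpha> A \<epsilon> k
    using one_le_scale[OF that(1), of k] packing_term_nonneg[of \<alpha> A k 1]
    by (intro cSUP_upper2[OF bdd_above_packing_term[OF that], of 1]) auto
  have null_mono: "?g \<alpha> A \<epsilon> \<longlonglongrightarrow> 0"
    if "h \<longlonglongrightarrow> 0" "\<And>k. ?g \<alpha> A \<epsilon> k \<le> h k" "\<epsilon> \<in> {0<..<1}" "\<alpha> \<ge> 0" for \<alpha> A \<epsilon> h
    using that nonneg[OF that(3,4)]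
    by (intro tendsto_sandwich[OF _ _ tendsto_const that(1)]) auto
  have mono: "?g \<alpha> A \<epsilon> k \<le> ?g \<alpha> B \<epsilon> k" if "A \<subseteq> B" "\<epsilon> \<in> {0<..<1}" "\<alpha> \<ge> 0" for A B \<alpha> \<epsilon> k
    using that by (intro cSUP_mono ne bdd_above_packing_term) (auto intro: packing_term_mono)
  have Un: "?g \<alpha> (A \<union> B) \<epsilon> k \<le> ?g \<alpha> A \<epsilon> k + ?g \<alpha> B \<epsilon> k"
    if "\<epsilon> \<in> {0<..<1}" "\<alpha> \<ge> 0" for A B \<alpha> \<epsilon> k
    using that
    by (intro cSUP_least ne order_trans[OF packing_term_Un] add_mono cSUP_upper
        bdd_above_packing_term)
  have expo: "?g \<beta> A \<epsilon> k \<le> ?g \<alpha> A \<epsilon> k" if "0 \<le> \<alpha>" "\<alpha> \<le> \<beta>" "\<epsilon> \<in> {0<..<1}" for A \<alpha> \<beta> \<epsilon> k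
  proof (rule cSUP_least[OF ne[OF that(3)]])
    fix r assume r: "r \<in> ?I \<epsilon> k"
    then have "packing_term \<beta> A k r \<le> packing_term \<alpha> A k r"
      using that scale_le[OF that(3)] by (intro packing_term_antimono_exponent) auto
    also have "\<dots> \<le> ?g \<alpha> A \<epsilon> k"
      using that by (intro cSUP_upper r bdd_above_packing_term)
    finally show "packing_term \<beta> A k r \<le> ?g \<alpha> A \<epsilon> k" .
  qed
  have sub: "?S C \<subseteq> ?S A" if "A \<subseteq> C" for A C
  proof
    fix \<alpha> assume \<alpha>: "\<alpha> \<in> ?S C"
    have "?g \<alpha> A \<epsilon> \<longlonglongrightarrow> 0" if \<epsilon>: "\<epsilon> \<in> {0<..<1}" for \<epsilon>
    proof (rule null_mono[where h = "?g \<alpha> C \<epsilon>"])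
      show "?g \<alpha> C \<epsilon> \<longlonglongrightarrow> 0" using \<alpha> \<epsilon> by blast
    qed (use \<alpha> \<epsilon> that mono[OF \<open>A \<subseteq> C\<close>] in blast)+
    then show "\<alpha> \<in> ?S A" using \<alpha> by blast
  qed
  have "?S A \<inter> ?S B \<subseteq> ?S (A \<union> B)"
  proof
    fix \<alpha> assume \<alpha>: "\<alpha> \<in> ?S A \<inter> ?S B"
    have "?g \<alpha> (A \<union> B) \<epsilon> \<longlonglongrightarrow> 0" if \<epsilon>: "\<epsilon> \<in> {0<..<1}" for \<epsilon>
    proof (rule null_mono[OF tendsto_add_zero Un])
      show "?g \<alpha> A \<epsilon> \<longlonglongrightarrow> 0" "?g \<alpha> B \<epsilon> \<longlonglongrightarrow> 0" using \<alpha> \<epsilon> by blast+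
    qed (use \<alpha> \<epsilon> in blast)+
    then show "\<alpha> \<in> ?S (A \<union> B)" using \<alpha> by blast
  qed
  then have "?S (A \<union> B) = ?S A \<inter> ?S B"
    using sub[OF Un_upper1, of A B] sub[OF Un_upper2, of A B] by (intro equalityI Int_greatest)
  moreover have "b \<in> ?S A" if ab: "a \<in> ?S A" "a \<le> b" for a b A
  proof -
    have "?g b A \<epsilon> \<longlonglongrightarrow> 0" if \<epsilon>: "\<epsilon> \<in> {0<..<1}" for \<epsilon>
    proof (rule null_mono)
      show "?g a A \<epsilon> \<longlonglongrightarrow> 0" using ab \<epsilon> by blast
      have a: "a \<ge> 0" using ab by blast
      show "b \<ge> 0" using a ab by linarith
      show "?g b A \<epsilon> k \<le> ?g a A \<epsilon> k" for k using a ab(2) \<epsilon> by (rule expo)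
    qed (rule \<epsilon>)
    moreover have "b \<ge> 0" using ab by auto
    ultimately show ?thesis by blast
  qed
  ultimately show ?thesis
    unfolding dim_DP_def by (simp only:) (intro Inf_Int_up_closed)
qed

section \<open>Covering numbers and the Assouad dimension\<close>

lemma finite_ball_emb: "finite {a \<in> A. emb a \<in> ball x R}"
proof -
  obtain M where M: "\<And>a. a \<in> ball x R \<Longrightarrow> norm a \<le> M"
    using bounded_ball[of x R] unfolding bounded_iff by blast
  have "{a \<in> A. emb a \<in> ball x R} \<subseteq> {-\<lceil>M\<rceil>..\<lceil>M\<rceil>} \<times> {-\<lceil>M\<rceil>..\<lceil>M\<rceil>}"
  proof
    fix a assume "a \<in> {a \<in> A. emb a \<in> ball x R}"
    then have "norm (emb a) \<le> M" using M by blast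
    then have "\<bar>real_of_int (fst a)\<bar> \<le> M" "\<bar>real_of_int (snd a)\<bar> \<le> M"
      using norm_fst_le[of "real_of_int (fst a)" "real_of_int (snd a)"]
        norm_snd_le[of "real_of_int (snd a)" "real_of_int (fst a)"] by (simp_all add: emb_def)
    then show "a \<in> {-\<lceil>M\<rceil>..\<lceil>M\<rceil>} \<times> {-\<lceil>M\<rceil>..\<lceil>M\<rceil>}"
      by (cases a) (simp, linarith)
  qed
  then show ?thesis by (rule finite_subset) auto
qed

lemma cover_number_le:
  assumes "finite T" "emb ` A \<subseteq> (\<Union>c\<in>T. square r c)"
  shows "cover_number r A \<le> card T"
  unfolding cover_number_def using assms by (intro Least_le) blast

lemma cover_number_attained:
  assumes "finite A" "r \<ge> 0"
  obtains T where "finite T" "card T = cover_number r A" "emb ` A \<subseteq> (\<Union>c\<in>T. square r c)"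
proof -
  have "emb ` A \<subseteq> (\<Union>c\<in>emb ` A. square r c)"
  proof
    fix y assume "y \<in> emb ` A"
    moreover have "y \<in> square r y" using assms by (cases y) (simp add: square_def)
    ultimately show "y \<in> (\<Union>c\<in>emb ` A. square r c)" by blast
  qed
  then have "\<exists>N T. finite T \<and> card T = N \<and> emb ` A \<subseteq> (\<Union>c\<in>T. square r c)"
    using assms by blast
  from LeastI_ex[OF this] obtain T where "finite T" "card T = cover_number r A"
    "emb ` A \<subseteq> (\<Union>c\<in>T. square r c)"
    unfolding cover_number_def[symmetric] by (elim exE conjE)
  then show ?thesis by (rule that)
qed

lemma cover_number_mono:
  assumes "finite B" "A \<subseteq> B" "r \<ge> 0"
  shows "cover_number r A \<le> cover_number r B"
proof -
  obtain T where T: "finite T" "card T = cover_number r B" "emb ` B \<subseteq> (\<Union>c\<in>T. square r c)"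
    using cover_number_attained[OF assms(1,3)] .
  have "emb ` A \<subseteq> (\<Union>c\<in>T. square r c)" using assms(2) T(3) by (meson image_mono order_trans)
  from cover_number_le[OF T(1) this] T(2) show ?thesis by simp
qed

lemma cover_number_Un:
  assumes "finite A" "finite B" "r \<ge> 0"
  shows "cover_number r (A \<union> B) \<le> cover_number r A + cover_number r B"
proof -
  obtain S where S: "finite S" "card S = cover_number r A" "emb ` A \<subseteq> (\<Union>c\<in>S. square r c)"
    using cover_number_attained[OF assms(1,3)] .
  obtain T where T: "finite T" "card T = cover_number r B" "emb ` B \<subseteq> (\<Union>c\<in>T. square r c)"
    using cover_number_attained[OF assms(2,3)] .
  have "cover_number r (A \<union> B) \<le> card (S \<union> T)"
    using S T by (intro cover_number_le) auto
  also have "\<dots> \<le> card S + card T" by (rule card_Un_le)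
  finally show ?thesis using S T by simp
qed

definition assouad_bound :: "real \<Rightarrow> (int \<times> int) set \<Rightarrow> real \<Rightarrow> bool" where
  "assouad_bound \<alpha> A C \<longleftrightarrow> (\<forall>x\<in>A. \<forall>r R. 1 \<le> r \<and> r < R \<longrightarrow>
     real (cover_number r {a \<in> A. emb a \<in> ball (emb x) R}) \<le> C * (R / r) powr \<alpha>)"

lemma assouad_boundD:
  "assouad_bound \<alpha> A C \<Longrightarrow> x \<in> A \<Longrightarrow> 1 \<le> r \<Longrightarrow> r < R \<Longrightarrow>
     real (cover_number r {a \<in> A. emb a \<in> ball (emb x) R}) \<le> C * (R / r) powr \<alpha>"
  by (simp add: assouad_bound_def)

text \<open>In a union, a ball centred in one set must be covered inside the other, whose bound only
  concerns its own points. Recentring at any point of the set within the ball doubles the radius,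
  which costs the factor \<open>2 powr \<alpha>\<close>.\<close>

lemma assouad_bound_any_center:
  assumes "assouad_bound \<alpha> A C" "C > 0" "\<alpha> \<ge> 0" "1 \<le> r" "r < R"
  shows "real (cover_number r {a \<in> A. emb a \<in> ball w R}) \<le> C * 2 powr \<alpha> * (R / r) powr \<alpha>"
proof (cases "{a \<in> A. emb a \<in> ball w R} = {}")
  case True
  have "cover_number r {} \<le> card ({} :: (real \<times> real) set)"
    by (rule cover_number_le) auto
  with assms show ?thesis unfolding True by simp
next
  case False
  then obtain y where y: "y \<in> A" "emb y \<in> ball w R" by blast
  have "dist (emb y) (emb a) < 2 * R" if "emb a \<in> ball w R" for a
    using that y dist_triangle2[of "emb y" "emb a" w] by (simp add: dist_commute)
  then have "cover_number r {a \<in> A. emb a \<in> ball w R}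
      \<le> cover_number r {a \<in> A. emb a \<in> ball (emb y) (2 * R)}"
    using assms by (intro cover_number_mono finite_ball_emb) auto
  also have "real \<dots> \<le> C * (2 * R / r) powr \<alpha>"
    using assms y by (intro assouad_boundD) auto
  also have "(2 * R / r) powr \<alpha> = 2 powr \<alpha> * (R / r) powr \<alpha>"
    using assms powr_mult[of 2 "R / r" \<alpha>] by simp
  finally show ?thesis by (simp add: mult.assoc)
qed

lemma dim_A_Un: "dim_A (A \<union> B) = max (dim_A A) (dim_A B)"
proof -
  let ?S = "\<lambda>A. {\<alpha>. \<alpha> \<ge> 0 \<and> (\<exists>C>0. assouad_bound \<alpha> A C)}"
  have mono: "assouad_bound \<alpha> A C" if "A \<subseteq> B" "assouad_bound \<alpha> B C" for A B \<alpha> C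
    unfolding assouad_bound_def
  proof (intro ballI allI impI; elim conjE)
    fix x and r R :: real assume xr: "x \<in> A" "1 \<le> r" "r < R"
    have "cover_number r {a \<in> A. emb a \<in> ball (emb x) R}
        \<le> cover_number r {a \<in> B. emb a \<in> ball (emb x) R}"
      using xr that by (intro cover_number_mono finite_ball_emb) auto
    also have "real \<dots> \<le> C * (R / r) powr \<alpha>"
      using that xr by (intro assouad_boundD) auto
    finally show "real (cover_number r {a \<in> A. emb a \<in> ball (emb x) R}) \<le> C * (R / r) powr \<alpha>"
      by simp
  qed
  have Un: "assouad_bound \<alpha> (A \<union> B) (C * 2 powr \<alpha> + D * 2 powr \<alpha>)"
    if "assouad_bound \<alpha> A C" "assouad_bound \<alpha> B D" "C > 0" "D > 0" "\<alpha> \<ge> 0" for A B \<alpha> C D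
    unfolding assouad_bound_def
  proof (intro ballI allI impI; elim conjE)
    fix x and r R :: real assume xr: "1 \<le> r" "r < R"
    have eq: "{a \<in> A \<union> B. emb a \<in> ball (emb x) R}
        = {a \<in> A. emb a \<in> ball (emb x) R} \<union> {a \<in> B. emb a \<in> ball (emb x) R}" by auto
    have "real (cover_number r {a \<in> A \<union> B. emb a \<in> ball (emb x) R})
      \<le> real (cover_number r {a \<in> A. emb a \<in> ball (emb x) R})
        + real (cover_number r {a \<in> B. emb a \<in> ball (emb x) R})"
      unfolding eq of_nat_add[symmetric] of_nat_le_iff
      using xr by (intro cover_number_Un finite_ball_emb) auto
    also have "\<dots> \<le> C * 2 powr \<alpha> * (R / r) powr \<alpha> + D * 2 powr \<alpha> * (R / r) powr \<alpha>"
      using that xr by (intro add_mono assouad_bound_any_center)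
    finally show "real (cover_number r {a \<in> A \<union> B. emb a \<in> ball (emb x) R})
      \<le> (C * 2 powr \<alpha> + D * 2 powr \<alpha>) * (R / r) powr \<alpha>"
      by (simp add: distrib_right)
  qed
  have "?S (A \<union> B) = ?S A \<inter> ?S B"
  proof (intro equalityI subsetI)
    fix \<alpha> assume "\<alpha> \<in> ?S (A \<union> B)"
    then show "\<alpha> \<in> ?S A \<inter> ?S B"
      using mono[of A "A \<union> B"] mono[of B "A \<union> B"] by blast
  next
    fix \<alpha> assume "\<alpha> \<in> ?S A \<inter> ?S B"
    then obtain C D where "C > 0" "D > 0" "\<alpha> \<ge> 0" "assouad_bound \<alpha> A C" "assouad_bound \<alpha> B D"
      by blast
    moreover from this have "C * 2 powr \<alpha> + D * 2 powr \<alpha> > 0" by (simp add: add_pos_pos)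
    ultimately show "\<alpha> \<in> ?S (A \<union> B)" using Un by blast
  qed
  moreover have "b \<in> ?S A" if "a \<in> ?S A" "a \<le> b" for a b A
  proof -
    obtain C where C: "C > 0" "assouad_bound a A C" "a \<ge> 0" using \<open>a \<in> ?S A\<close> by blast
    have "assouad_bound b A C"
      unfolding assouad_bound_def
    proof (intro ballI allI impI; elim conjE)
      fix x and r R :: real assume xr: "x \<in> A" "1 \<le> r" "r < R"
      have "C * (R / r) powr a \<le> C * (R / r) powr b"
        using C that xr by (intro mult_left_mono powr_mono) auto
      then show "real (cover_number r {a \<in> A. emb a \<in> ball (emb x) R}) \<le> C * (R / r) powr b"
        using assouad_boundD[OF C(2) xr] by simp
    qed
    with C that show ?thesis by auto
  qed
  ultimately show ?thesis
    unfolding dim_A_def assouad_bound_def[symmetric]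
    by (simp only:) (intro Inf_Int_up_closed)
qed

section \<open>Mass and Beurling dimensions of unions\<close>

lemma finite_window: "finite {a \<in> A. emb a - w \<in> {-h..h} \<times> {-h..h}}"
proof -
  have "{a \<in> A. emb a - w \<in> {-h..h} \<times> {-h..h}} \<subseteq> {a \<in> A. emb a \<in> ball w (2 * \<bar>h\<bar> + 1)}"
  proof
    fix a assume a: "a \<in> {a \<in> A. emb a - w \<in> {-h..h} \<times> {-h..h}}"
    have "norm (emb a - w) \<le> norm (fst (emb a - w)) + norm (snd (emb a - w))"
      by (metis norm_Pair_le prod.collapse)
    also have "\<dots> \<le> \<bar>h\<bar> + \<bar>h\<bar>" using a by (intro add_mono) (auto simp: mem_Times_iff)
    finally show "a \<in> {a \<in> A. emb a \<in> ball w (2 * \<bar>h\<bar> + 1)}"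
      using a by (simp add: dist_norm norm_minus_commute)
  qed
  then show ?thesis by (rule finite_subset) (rule finite_ball_emb)
qed

lemma window_count_mono: "A \<subseteq> B \<Longrightarrow> window_count A w h \<le> window_count B w h"
  unfolding window_count_def by (intro card_mono finite_window) auto

lemma window_count_Un: "window_count (A \<union> B) w h \<le> window_count A w h + window_count B w h"
proof -
  have "{a \<in> A \<union> B. emb a - w \<in> {-h..h} \<times> {-h..h}}
    = {a \<in> A. emb a - w \<in> {-h..h} \<times> {-h..h}} \<union> {a \<in> B. emb a - w \<in> {-h..h} \<times> {-h..h}}"
    by blast
  then show ?thesis unfolding window_count_def by (simp only: card_Un_le)
qed

lemma elog_mono: "M \<le> N \<Longrightarrow> elog M \<le> elog N"
  by (simp add: elog_def)

lemma elog_quotient_mono: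
  "M \<le> N \<Longrightarrow> h > 1 \<Longrightarrow> elog M / ereal (ln h) \<le> elog N / ereal (ln h)"
  by (intro ereal_divide_right_mono elog_mono) auto

text \<open>A sum is at most twice the larger term, so the logarithm grows by at most
  \<open>ln 2\<close>, which vanishes after division by \<open>ln h\<close>.\<close>

lemma elog_quotient_add:
  assumes "h > (1::real)"
  shows "elog (M + N) / ereal (ln h)
    \<le> max (elog M / ereal (ln h)) (elog N / ereal (ln h)) + ereal (ln 2 / ln h)"
proof (cases "M + N = 0")
  case True
  then show ?thesis using assms by (simp add: elog_def)
next
  case False
  let ?P = "max M N"
  have P: "?P > 0" "M + N \<le> 2 * ?P" using False by auto
  then have "ln (real (M + N)) \<le> ln (real (2 * ?P))"
    using False by (intro ln_mono) (simp_all only: of_nat_le_iff of_nat_0_less_iff)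
  also have "\<dots> = ln (real ?P) + ln 2"
    using P(1) unfolding of_nat_mult by (subst ln_mult) auto
  finally have "ln (real (M + N)) / ln h \<le> ln (real ?P) / ln h + ln 2 / ln h"
    using assms by (simp add: divide_simps del: of_nat_max of_nat_add)
  then have "elog (M + N) / ereal (ln h) \<le> elog ?P / ereal (ln h) + ereal (ln 2 / ln h)"
    using False P assms by (simp add: elog_def del: of_nat_max of_nat_add)
  also have "elog ?P / ereal (ln h) \<le> max (elog M / ereal (ln h)) (elog N / ereal (ln h))"
    by (auto simp: max_def)
  finally show ?thesis by (simp add: add_right_mono)
qed

lemma log_count_Un_upper:
  assumes "h > 1"
  shows "elog (window_count (A \<union> B) w h) / ereal (ln h)
    \<le> max (elog (window_count A w h) / ereal (ln h)) (elog (window_count B w h) / ereal (ln h))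
      + ereal (ln 2 / ln h)"
  using elog_quotient_mono[OF window_count_Un assms] elog_quotient_add[OF assms]
  by (rule order_trans)

lemma log_count_Un_lower:
  assumes "h > 1"
  shows "max (elog (window_count A w h) / ereal (ln h)) (elog (window_count B w h) / ereal (ln h))
    \<le> elog (window_count (A \<union> B) w h) / ereal (ln h)"
  using assms by (intro max.boundedI elog_quotient_mono window_count_mono) auto

lemma tendsto_const_over_ln: "((\<lambda>h. c / ln h) \<longlongrightarrow> 0) (at_top :: real filter)"
  by (rule tendsto_divide_0[OF tendsto_const])
    (intro filterlim_at_top_imp_at_infinity ln_at_top)

lemma dim_Be_Un: "dim_Be (A \<union> B) = max (dim_Be A) (dim_Be B)"
proof (rule antisym)
  let ?f = "\<lambda>A w h. elog (window_count A w h) / ereal (ln h)"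
  have mono: "dim_Be A \<le> dim_Be C" if "A \<subseteq> C" for A C
    unfolding dim_Be_def
    by (intro Limsup_mono eventually_mono[OF eventually_gt_at_top[of 1]] SUP_mono'
        elog_quotient_mono window_count_mono that)
  show "max (dim_Be A) (dim_Be B) \<le> dim_Be (A \<union> B)"
    by (intro max.boundedI mono) auto
  show "dim_Be (A \<union> B) \<le> max (dim_Be A) (dim_Be B)"
  proof (rule dense_ge)
    fix y assume "max (dim_Be A) (dim_Be B) < y"
    \<comment> \<open>The gap between s and the later t absorbs the error
      \<open>ln 2 / ln h\<close>. That error does not depend on the centre w, so it survives the
      supremum over windows.\<close>
    then obtain s where s: "max (dim_Be A) (dim_Be B) < ereal s" "ereal s < y"
      using ereal_dense2 by blast
    then obtain t where t: "ereal s < ereal t" "ereal t < y"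
      using ereal_dense2 by blast
    have lt: "\<forall>\<^sub>F h in at_top. (SUP w. ?f A w h) < ereal s" "\<forall>\<^sub>F h in at_top. (SUP w. ?f B w h) < ereal s"
      using s(1) unfolding dim_Be_def by (simp_all add: Limsup_lessD)
    have "\<forall>\<^sub>F h::real in at_top. ln 2 / ln h < t - s"
      using t by (intro order_tendstoD(2)[OF tendsto_const_over_ln]) simp
    with lt eventually_gt_at_top[of 1] have "\<forall>\<^sub>F h in at_top. (SUP w. ?f (A \<union> B) w h) \<le> ereal t"
    proof eventually_elim
      case (elim h)
      show ?case
      proof (rule SUP_least)
        fix w
        have "?f A w h \<le> ereal s" "?f B w h \<le> ereal s"
          using elim(1,2) by (meson SUP_upper UNIV_I less_imp_le order_trans)+
        then have "max (?f A w h) (?f B w h) + ereal (ln 2 / ln h) \<le> ereal s + ereal (t - s)"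
          using elim by (intro add_mono max.boundedI) auto
        then show "?f (A \<union> B) w h \<le> ereal t"
          using log_count_Un_upper[OF elim(3), of A B w] by (simp add: order_trans)
      qed
    qed
    then have "dim_Be (A \<union> B) \<le> ereal t"
      unfolding dim_Be_def by (rule Limsup_bounded)
    then show "dim_Be (A \<union> B) \<le> y" using t by simp
  qed
qed

text \<open>A full limit rather than the value of \<open>dim_M\<close>: the lower limit of a maximum
  may exceed the maximum of the lower limits, so \<open>dim_LM\<close> alone would not pass to
  unions.\<close>

definition has_mass_dim :: "(int \<times> int) set \<Rightarrow> real \<Rightarrow> bool" where
  "has_mass_dim A L \<longleftrightarrow> ((\<lambda>h. elog (window_count A 0 h) / ereal (ln h)) \<longlongrightarrow> ereal L) at_top"

lemma has_mass_dimD: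
  assumes "has_mass_dim A L"
  shows "dim_LM A = ereal L" "dim_UM A = ereal L" "dim_M A = ereal L"
  using assms unfolding has_mass_dim_def dim_M_def dim_LM_def dim_UM_def
  by (simp_all add: lim_imp_Liminf lim_imp_Limsup)

lemma has_mass_dim_Un:
  assumes "has_mass_dim A L" "has_mass_dim B M"
  shows "has_mass_dim (A \<union> B) (max L M)"
  unfolding has_mass_dim_def
proof (rule tendsto_sandwich)
  let ?m = "\<lambda>h. max (elog (window_count A 0 h) / ereal (ln h)) (elog (window_count B 0 h) / ereal (ln h))"
  show lim: "(?m \<longlongrightarrow> ereal (max L M)) at_top"
    using tendsto_max[OF assms[unfolded has_mass_dim_def]] by simp
  have fin: "\<bar>ereal x\<bar> \<noteq> \<infinity>" for x by simp
  have "((\<lambda>h. ?m h + ereal (ln 2 / ln h)) \<longlongrightarrow> ereal (max L M) + ereal 0) at_top"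
    by (rule tendsto_add_ereal[OF fin fin lim tendsto_ereal[OF tendsto_const_over_ln]])
  then show "((\<lambda>h. ?m h + ereal (ln 2 / ln h)) \<longlongrightarrow> ereal (max L M)) at_top" by simp
  show "\<forall>\<^sub>F h in at_top. ?m h \<le> elog (window_count (A \<union> B) 0 h) / ereal (ln h)"
    using eventually_gt_at_top[of 1] by eventually_elim (rule log_count_Un_lower)
  show "\<forall>\<^sub>F h in at_top. elog (window_count (A \<union> B) 0 h) / ereal (ln h) \<le> ?m h + ereal (ln 2 / ln h)"
    using eventually_gt_at_top[of 1] by eventually_elim (rule log_count_Un_upper)
qed

lemma has_mass_dim_UNION:
  assumes "finite I" "I \<noteq> {}" "\<And>i. i \<in> I \<Longrightarrow> has_mass_dim (X i) (L i)"
  shows "has_mass_dim (\<Union>i\<in>I. X i) (MAX i\<in>I. L i)"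
  using assms by (induction I rule: finite_ne_induct) (auto intro: has_mass_dim_Un)

lemma has_mass_dimI:
  assumes "\<And>h. h > 1 \<Longrightarrow> window_count A 0 h > 0"
    and "\<And>h. h > 1 \<Longrightarrow> \<bar>ln (real (window_count A 0 h)) - L * ln h\<bar> \<le> c"
  shows "has_mass_dim A L"
proof -
  have "((\<lambda>h. ln (real (window_count A 0 h)) / ln h) \<longlongrightarrow> L) at_top"
  proof (rule LIM_zero_cancel, rule Lim_null_comparison[OF _ tendsto_const_over_ln[of c]])
    show "\<forall>\<^sub>F h in at_top. norm (ln (real (window_count A 0 h)) / ln h - L) \<le> c / ln h"
      using eventually_gt_at_top[of 1]
    proof eventually_elim
      case (elim h)
      have "ln (real (window_count A 0 h)) / ln h - L
        = (ln (real (window_count A 0 h)) - L * ln h) / ln h"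
        using elim by (simp add: field_simps)
      then show ?case
        using elim assms(2)[OF elim] by (simp add: divide_right_mono)
    qed
  qed
  then have "((\<lambda>h. ereal (ln (real (window_count A 0 h)) / ln h)) \<longlongrightarrow> ereal L) at_top"
    by (rule tendsto_ereal)
  then show ?thesis
    unfolding has_mass_dim_def
  proof (rule Lim_transform_eventually)
    show "\<forall>\<^sub>F h in at_top. ereal (ln (real (window_count A 0 h)) / ln h)
        = elog (window_count A 0 h) / ereal (ln h)"
      using eventually_gt_at_top[of 1]
    proof eventually_elim
      case (elim h)
      then show ?case using assms(1)[OF elim] by (simp add: elog_def)
    qed
  qed
qed

section \<open>Comparing lower entropy indices\<close>

lemma INF_packing_term_nonneg:
  assumes "\<epsilon> \<in> {0<..<1}"
  shows "0 \<le> (INF r\<in>{1..2 powr (real k * (1 - \<epsilon>))}. packing_term \<alpha> A k r)"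
  using one_le_scale[OF assms, of k] by (intro cINF_greatest packing_term_nonneg) auto

lemma bdd_below_packing_term: "bdd_below (packing_term \<alpha> A k ` I)"
  by (rule bdd_belowI2[where m = 0]) (rule packing_term_nonneg)

text \<open>Both sides are compared at the same r, so that the comparison survives the infimum over
  scales. Moving the shell index by at most c changes \<open>(r / 2 ^ k) powr \<alpha>\<close> by a
  factor of at most \<open>2 powr (real c * \<alpha>)\<close>. The different range of scales is
  absorbed by halving \<epsilon>, which is allowed because the index asks for some \<epsilon>
  only.\<close>

lemma lower_entropy_index_le:
  fixes \<kappa> :: "nat \<Rightarrow> nat" and C :: real
  assumes C: "C \<ge> 0" and \<kappa>: "\<And>k. k \<ge> k0 \<Longrightarrow> k \<le> \<kappa> k \<and> \<kappa> k \<le> k + c"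
    and pack: "\<And>k r. k \<ge> k0 \<Longrightarrow> 1 \<le> r \<Longrightarrow>
      real (packing_number r (A \<inter> shell k)) \<le> C * real (packing_number r (B \<inter> shell (\<kappa> k)))"
  shows "lower_entropy_index A \<le> lower_entropy_index B"
  unfolding lower_entropy_index_def
proof (intro Inf_superset_mono image_mono subsetI CollectI)
  let ?I = "\<lambda>\<epsilon> k. {1..2 powr (real k * (1 - \<epsilon>))}"
  fix \<alpha> assume "\<alpha> \<in> {\<alpha>. \<alpha> \<ge> 0 \<and> (\<exists>\<epsilon>\<in>{0<..<1}.
     (\<lambda>k. INF r\<in>?I \<epsilon> k. packing_term \<alpha> B k r) \<longlonglongrightarrow> 0)}"
  then obtain \<epsilon> where \<alpha>: "\<alpha> \<ge> 0" and \<epsilon>: "\<epsilon> \<in> {0<..<1}"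
    and lim: "(\<lambda>k. INF r\<in>?I \<epsilon> k. packing_term \<alpha> B k r) \<longlonglongrightarrow> 0" by blast
  have \<epsilon>2: "\<epsilon> / 2 \<in> {0<..<1}" using \<epsilon> by auto
  have "filterlim \<kappa> at_top sequentially"
    by (rule filterlim_at_top_mono[OF filterlim_ident])
      (use \<kappa> in \<open>auto simp: eventually_sequentially\<close>)
  from filterlim_compose[OF lim this]
  have "(\<lambda>k. INF r\<in>?I \<epsilon> (\<kappa> k). packing_term \<alpha> B (\<kappa> k) r) \<longlonglongrightarrow> 0" .
  from tendsto_mult_left[OF this, of "2 powr (real c * \<alpha>) * C"]
  have lim': "(\<lambda>k. 2 powr (real c * \<alpha>) * C * (INF r\<in>?I \<epsilon> (\<kappa> k). packing_term \<alpha> B (\<kappa> k) r)) \<longlonglongrightarrow> 0"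
    by simp
  \<comment> \<open>Beyond k1 the shift c is at most \<open>k * \<epsilon> / 2\<close>, so each
    scale admissible for shell \<open>\<kappa> k\<close> with \<epsilon> is admissible for shell k
    with \<open>\<epsilon> / 2\<close>.\<close>
  obtain k1 :: nat where k1: "real k1 * \<epsilon> \<ge> 2 * real c"
    using \<epsilon> ex_less_of_nat_mult[of \<epsilon> "2 * real c"] by (auto intro: less_imp_le)
  have "(INF r\<in>?I (\<epsilon> / 2) k. packing_term \<alpha> A k r)
      \<le> 2 powr (real c * \<alpha>) * C * (INF r\<in>?I \<epsilon> (\<kappa> k). packing_term \<alpha> B (\<kappa> k) r)"
    if k: "k \<ge> max k0 k1" for k
  proof -
    let ?D = "2 powr (real c * \<alpha>) * C"
    have \<kappa>k: "k \<le> \<kappa> k" "\<kappa> k \<le> k + c" using \<kappa> k by auto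
    have "real k1 * \<epsilon> \<le> real k * \<epsilon>" using k \<epsilon> by (intro mult_right_mono) auto
    with k1 have ck: "real c \<le> real k * \<epsilon> / 2" by simp
    have "real (\<kappa> k) * (1 - \<epsilon>) \<le> (real k + real c) * (1 - \<epsilon>)"
      using \<kappa>k(2) \<epsilon> by (intro mult_right_mono) (simp_all flip: of_nat_add)
    also have "\<dots> \<le> real k * (1 - \<epsilon>) + real c"
      using \<epsilon> by (simp add: algebra_simps)
    also have "\<dots> \<le> real k * (1 - \<epsilon> / 2)" using ck by (simp add: algebra_simps)
    finally have expo: "real (\<kappa> k) * (1 - \<epsilon>) \<le> real k * (1 - \<epsilon> / 2)" .
    have *: "(INF r\<in>?I (\<epsilon> / 2) k. packing_term \<alpha> A k r) \<le> ?D * packing_term \<alpha> B (\<kappa> k) r"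
      if r: "r \<in> ?I \<epsilon> (\<kappa> k)" for r
    proof -
      have "2 powr (real (\<kappa> k) * (1 - \<epsilon>)) \<le> 2 powr (real k * (1 - \<epsilon> / 2))"
        using expo by (rule powr_mono) simp
      with r have r': "r \<in> ?I (\<epsilon> / 2) k" by (meson atLeastAtMost_iff order_trans)
      then have "(INF r\<in>?I (\<epsilon> / 2) k. packing_term \<alpha> A k r) \<le> packing_term \<alpha> A k r"
        by (intro cINF_lower bdd_below_packing_term)
      also have "\<dots> \<le> (r / 2 ^ k) powr \<alpha> * (C * real (packing_number r (B \<inter> shell (\<kappa> k))))"
        unfolding packing_term_def using pack[of k r] k r by (intro mult_left_mono) auto
      also have "(r / 2 ^ k) powr \<alpha> \<le> (2 ^ c * (r / 2 ^ \<kappa> k)) powr \<alpha>"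
      proof (rule powr_mono2[OF \<alpha>])
        show "0 \<le> r / 2 ^ k" using r by simp
        have "(2::real) ^ \<kappa> k \<le> 2 ^ (k + c)" using \<kappa>k by (intro power_increasing) auto
        then show "r / 2 ^ k \<le> 2 ^ c * (r / 2 ^ \<kappa> k)"
          using r by (simp add: power_add field_simps mult_left_mono)
      qed
      also have "\<dots> = (2 ^ c) powr \<alpha> * (r / 2 ^ \<kappa> k) powr \<alpha>"
        using r by (simp only: powr_mult)
      also have "(2 ^ c) powr \<alpha> = 2 powr (real c * \<alpha>)"
        by (simp add: powr_powr flip: powr_realpow)
      finally show ?thesis
        using C unfolding packing_term_def by (simp add: mult_ac mult_right_mono)
    qed
    show ?thesis
    proof (cases "?D = 0")
      case True
      have "1 \<in> ?I \<epsilon> (\<kappa> k)" using one_le_scale[OF \<epsilon>] by simp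
      from *[OF this] show ?thesis unfolding True by simp
    next
      case False
      then have D: "?D > 0" using C by simp
      have "(INF r\<in>?I (\<epsilon> / 2) k. packing_term \<alpha> A k r) / ?D
          \<le> (INF r\<in>?I \<epsilon> (\<kappa> k). packing_term \<alpha> B (\<kappa> k) r)"
      proof (rule cINF_greatest)
        show "?I \<epsilon> (\<kappa> k) \<noteq> {}" using one_le_scale[OF \<epsilon>, of "\<kappa> k"] by simp
        show "(INF r\<in>?I (\<epsilon> / 2) k. packing_term \<alpha> A k r) / ?D \<le> packing_term \<alpha> B (\<kappa> k) r"
          if "r \<in> ?I \<epsilon> (\<kappa> k)" for r
          using *[OF that] D by (simp add: pos_divide_le_eq mult.commute)
      qed
      then show ?thesis using D by (simp add: pos_divide_le_eq mult.commute)
    qed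
  qed
  then have "\<forall>\<^sub>F k in sequentially. (INF r\<in>?I (\<epsilon> / 2) k. packing_term \<alpha> A k r)
      \<le> 2 powr (real c * \<alpha>) * C * (INF r\<in>?I \<epsilon> (\<kappa> k). packing_term \<alpha> B (\<kappa> k) r)"
    unfolding eventually_sequentially by blast
  then have "(\<lambda>k. INF r\<in>?I (\<epsilon> / 2) k. packing_term \<alpha> A k r) \<longlonglongrightarrow> 0"
    by (intro tendsto_sandwich[OF _ _ tendsto_const lim'])
      (auto intro: always_eventually INF_packing_term_nonneg[OF \<epsilon>2])
  with \<alpha> \<epsilon>2 show "\<alpha> \<ge> 0 \<and> (\<exists>\<epsilon>\<in>{0<..<1}.
     (\<lambda>k. INF r\<in>?I \<epsilon> k. packing_term \<alpha> A k r) \<longlonglongrightarrow> 0)" by blast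
qed

lemma lower_entropy_index_mono:
  assumes "A \<subseteq> B"
  shows "lower_entropy_index A \<le> lower_entropy_index B"
proof (rule lower_entropy_index_le[where \<kappa> = "\<lambda>k. k" and C = 1 and c = 0 and ?k0.0 = 0])
  fix k and r :: real
  have "packing_number r (A \<inter> shell k) \<le> packing_number r (B \<inter> shell k)"
    using assms by (intro packing_number_mono) (auto intro: finite_shell)
  then show "real (packing_number r (A \<inter> shell k)) \<le> 1 * real (packing_number r (B \<inter> shell k))"
    by simp
qed auto

section \<open>Integers in terms of their digits\<close>

lemma div_mod_digit:
  fixes M x i :: int
  assumes "0 \<le> i" "i < M"
  shows "(M * x + i) div M = x" "(M * x + i) mod M = i"
  using assms by (simp_all add: div_pos_pos_trivial)

lemma digit_unique:
  fixes M x y i j :: int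
  assumes "M * x + i = M * y + j" "0 \<le> i" "i < M" "0 \<le> j" "j < M"
  shows "x = y \<and> i = j"
  by (metis assms div_mod_digit)

text \<open>The reflection \<open>x \<mapsto> -1 - x\<close> exchanges the digit \<open>i\<close> with \<open>M - 1 - i\<close> and preserves
  the half-open shells, so each quadrant is treated like the first one.\<close>

definition bar :: "int \<Rightarrow> int" where
  "bar x = (if x \<ge> 0 then x else - 1 - x)"

definition rel_digit :: "int \<Rightarrow> int \<Rightarrow> int \<Rightarrow> int" where
  "rel_digit M x i = (if x \<ge> 0 then i else M - 1 - i)"

lemma bar_nonneg: "bar x \<ge> 0"
  by (simp add: bar_def)

lemma bar_le_abs: "bar x \<le> \<bar>x\<bar>" "\<bar>x\<bar> \<le> bar x + 1"
  by (simp_all add: bar_def)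

lemma rel_digit_range: "0 \<le> i \<Longrightarrow> i < M \<Longrightarrow> 0 \<le> rel_digit M x i \<and> rel_digit M x i < M"
  by (simp add: rel_digit_def)

text \<open>Floor division by the positive M recovers x and preserves the sign. Hence no orbit
  leaves the quadrant in which it starts.\<close>

lemma sign_step:
  fixes M x i :: int
  assumes "0 \<le> i" "i < M"
  shows "0 \<le> M * x + i \<longleftrightarrow> 0 \<le> x"
proof -
  have "0 \<le> M * x + i \<longleftrightarrow> 0 \<le> (M * x + i) div M"
    using assms by (simp add: pos_imp_zdiv_nonneg_iff del: div_mult_self4)
  then show ?thesis using assms by (simp add: div_mod_digit)
qed

lemma bar_step:
  fixes M x i :: int
  assumes "0 \<le> i" "i < M"
  shows "bar (M * x + i) = M * bar x + rel_digit M x i"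
proof (cases "x \<ge> 0")
  case True
  then show ?thesis using sign_step[OF assms, of x] by (simp add: bar_def rel_digit_def)
next
  case False
  then have "\<not> 0 \<le> M * x + i" using sign_step[OF assms, of x] by simp
  then show ?thesis using False by (simp add: bar_def rel_digit_def algebra_simps)
qed

lemma bar_less_step:
  fixes M x i :: int
  assumes "0 \<le> i" "i < M" "bar (M * x + i) < M ^ Suc q"
  shows "bar x < M ^ q"
proof -
  have "M * bar x \<le> bar (M * x + i)"
    using bar_step[OF assms(1,2), of x] rel_digit_range[OF assms(1,2), of x] by simp
  also have "\<dots> < M * M ^ q" using assms(3) by simp
  finally show ?thesis using assms(1,2) by (simp add: mult_less_cancel_left_pos)
qed

text \<open>The half-open cubes about 0 are not balls of the maximum norm, as they admit the
  coordinate \<open>- (2 ^ j)\<close> but not \<open>2 ^ j\<close>. Measuring negative coordinates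
  from -1 turns them into sublevel sets.\<close>

definition gauge :: "int \<times> int \<Rightarrow> int" where
  "gauge z = max (bar (fst z)) (bar (snd z))"

lemma centered_cube_iff_gauge: "z \<in> centered_cube 0 (2 ^ Suc j) \<longleftrightarrow> gauge z < 2 ^ j"
proof -
  have "- (2 ^ j) \<le> real_of_int a \<and> real_of_int a < 2 ^ j \<longleftrightarrow> bar a < 2 ^ j" for a
  proof -
    have "- (2 ^ j) \<le> real_of_int a \<longleftrightarrow> real_of_int (- (2 ^ j)) \<le> real_of_int a"
      "real_of_int a < 2 ^ j \<longleftrightarrow> real_of_int a < real_of_int (2 ^ j)" by simp_all
    then show ?thesis unfolding of_int_le_iff of_int_less_iff by (auto simp: bar_def)
  qed
  then show ?thesis by (auto simp: centered_cube_def gauge_def)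
qed

text \<open>Side \<open>2 ^ k\<close> means half-side \<open>2 ^ (k - 1)\<close>, so shell k lies
  between the half-sides \<open>2 ^ (k - 2)\<close> and \<open>2 ^ (k - 1)\<close>. The offset 2
  also skips the exceptional first shell.\<close>

lemma shell_iff_gauge: "z \<in> shell (j + 2) \<longleftrightarrow> 2 ^ j \<le> gauge z \<and> gauge z < 2 ^ Suc j"
  using centered_cube_iff_gauge[of z j] centered_cube_iff_gauge[of z "Suc j"]
  by (auto simp: shell_def)

lemma ex_power_bracket:
  fixes b x :: real
  assumes "b > 1" "x \<ge> 1"
  obtains a where "b ^ a \<le> x" "x < b ^ Suc a"
proof -
  have ex: "\<exists>k. x < b ^ k" using assms(1) real_arch_pow by blast
  define k where "k = (LEAST k. x < b ^ k)"
  have k: "x < b ^ k" unfolding k_def using ex by (rule LeastI_ex)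
  then obtain a where a: "k = Suc a" using assms by (cases k) auto
  have "\<not> x < b ^ a"
    using not_less_Least[of a "\<lambda>k. x < b ^ k"] a unfolding k_def by simp
  with k a show ?thesis using that[of a] by simp
qed

lemma ex_power_bracket_int:
  fixes b x :: int
  assumes "b > 1" "x \<ge> 1"
  obtains a where "b ^ a \<le> x" "x < b ^ Suc a"
proof -
  obtain a where "real_of_int b ^ a \<le> real_of_int x" "real_of_int x < real_of_int b ^ Suc a"
    using ex_power_bracket[of "real_of_int b" "real_of_int x"] assms by auto
  then show ?thesis
    using that unfolding of_int_power[symmetric] of_int_le_iff of_int_less_iff by blast
qed

lemma int_less_power: "b \<ge> 2 \<Longrightarrow> (x::int) < b ^ nat x"
proof -
  assume "b \<ge> 2"
  have "x < 2 ^ nat x" using of_nat_less_two_power[of "nat x", where 'a = int] by (cases "x \<ge> 0") auto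
  also have "\<dots> \<le> b ^ nat x" using \<open>b \<ge> 2\<close> by (intro power_mono) auto
  finally show ?thesis .
qed

section \<open>Digit blocks and cells\<close>

locale digit_maps =
  fixes m n :: int and \<Lambda> :: "(int \<times> int) set"
  assumes two_le_n: "2 \<le> n" and n_le_m: "n \<le> m"
    and digits: "\<Lambda> \<subseteq> {0..m - 1} \<times> {0..n - 1}"
begin

abbreviation S where "S \<equiv> affine_map m n"

abbreviation all_digits where "all_digits \<equiv> {0..m - 1} \<times> {0..n - 1}"

lemma digitD: "d \<in> all_digits \<Longrightarrow> 0 \<le> fst d \<and> fst d < m \<and> 0 \<le> snd d \<and> snd d < n"
  by auto

lemma m_n_ge: "m \<ge> 2" "m > 0" "n > 0" "m > 1" "n > 1"
  using two_le_n n_le_m by auto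

lemma finite_digits: "\<Delta> \<subseteq> all_digits \<Longrightarrow> finite \<Delta>"
  by (rule finite_subset) auto

text \<open>The Hutchinson operator of the maps with digits in \<Delta>. Letting \<Delta> vary
  allows blocks in which some letters are confined to a column.\<close>

definition expand :: "(int \<times> int) set \<Rightarrow> (int \<times> int) set \<Rightarrow> (int \<times> int) set" where
  "expand \<Delta> X = (\<Union>d\<in>\<Delta>. S d ` X)"

lemma expandI: "d \<in> \<Delta> \<Longrightarrow> z \<in> X \<Longrightarrow> S d z \<in> expand \<Delta> X"
  by (auto simp: expand_def)

lemma expandE:
  assumes "w \<in> expand \<Delta> X" obtains d z where "d \<in> \<Delta>" "z \<in> X" "w = S d z"
  using assms by (auto simp: expand_def)

lemma finite_expand: "\<Delta> \<subseteq> all_digits \<Longrightarrow> finite X \<Longrightarrow> finite (expand \<Delta> X)"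
  unfolding expand_def using finite_digits by auto

lemma finite_expand_funpow: "\<Delta> \<subseteq> all_digits \<Longrightarrow> finite X \<Longrightarrow> finite ((expand \<Delta> ^^ q) X)"
  by (induction q) (auto intro: finite_expand)

lemma expand_funpow_subset:
  assumes "expand \<Delta> Y \<subseteq> Y" "X \<subseteq> Y"
  shows "(expand \<Delta> ^^ q) X \<subseteq> Y"
proof (induction q)
  case (Suc q)
  then have "expand \<Delta> ((expand \<Delta> ^^ q) X) \<subseteq> expand \<Delta> Y" unfolding expand_def by blast
  with assms show ?case by simp
qed (use assms in simp)

text \<open>Cells are rectangles of size \<open>m ^ a\<close> by \<open>n ^ b\<close>, obtained by
  dropping low-order digits. They replace squares of side r when both sides are comparable to r, and
  they are compatible with \<open>expand\<close>.\<close>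

definition cell :: "nat \<Rightarrow> nat \<Rightarrow> int \<times> int \<Rightarrow> int \<times> int" where
  "cell a b z = (fst z div m ^ a, snd z div n ^ b)"

text \<open>The part of the lowest digit that a cell still sees: a coordinate survives only if none
  of its digits has been dropped.\<close>

definition truncate :: "nat \<Rightarrow> nat \<Rightarrow> int \<times> int \<Rightarrow> int \<times> int" where
  "truncate a b d = (if a = 0 then fst d else 0, if b = 0 then snd d else 0)"

lemma div_power_step:
  fixes M x i :: int
  assumes "0 \<le> i" "i < M"
  shows "(M * x + i) div M ^ a
    = (if a = 0 then M else 1) * (x div M ^ (a - 1)) + (if a = 0 then i else 0)"
proof (cases a)
  case (Suc a')
  have "(M * x + i) div (M * M ^ a') = (M * x + i) div M div M ^ a'"
    using assms by (intro zdiv_zmult2_eq) auto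
  then show ?thesis using assms Suc by (simp only: div_mod_digit) simp
qed simp

text \<open>Dropping a digits of \<open>m * x + i\<close> either keeps i as the last digit (a = 0)
  or removes it and drops \<open>a - 1\<close> digits of x. Truncated subtraction merges both cases.
  Digits are unique, so visible digit and inner cell are independent and the counts
  multiply.\<close>

lemma card_cells_expand:
  assumes \<Delta>: "\<Delta> \<subseteq> all_digits"
  shows "card (cell a b ` expand \<Delta> X)
    = card (truncate a b ` \<Delta>) * card (cell (a - 1) (b - 1) ` X)"
proof -
  \<comment> \<open>When the lowest digit has been dropped, nothing is appended to the quotient:
    base 1 with digit 0.\<close>
  define M where "M = (if a = 0 then m else 1)"
  define N where "N = (if b = 0 then n else 1)"
  define g where "g = (\<lambda>(u, v). (M * fst v + fst u, N * snd v + snd u :: int))"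
  have cell_step: "cell a b (S d z) = g (truncate a b d, cell (a - 1) (b - 1) z)" if "d \<in> \<Delta>" for d z
  proof -
    have "0 \<le> fst d" "fst d < m" "0 \<le> snd d" "snd d < n" using that \<Delta> by auto
    then show ?thesis
      by (simp only: cell_def affine_map_def truncate_def g_def M_def N_def div_power_step
          fst_conv snd_conv case_prod_conv)
  qed
  have eq: "cell a b ` expand \<Delta> X = g ` (truncate a b ` \<Delta> \<times> cell (a - 1) (b - 1) ` X)"
  proof (intro equalityI subsetI)
    fix w assume "w \<in> cell a b ` expand \<Delta> X"
    then obtain d z where "d \<in> \<Delta>" "z \<in> X" "w = cell a b (S d z)" by (auto elim: expandE)
    then show "w \<in> g ` (truncate a b ` \<Delta> \<times> cell (a - 1) (b - 1) ` X)"
      using cell_step by (intro image_eqI[of _ g "(truncate a b d, cell (a - 1) (b - 1) z)"]) auto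
  next
    fix w assume "w \<in> g ` (truncate a b ` \<Delta> \<times> cell (a - 1) (b - 1) ` X)"
    then obtain d z where "d \<in> \<Delta>" "z \<in> X" "w = g (truncate a b d, cell (a - 1) (b - 1) z)" by auto
    then show "w \<in> cell a b ` expand \<Delta> X"
      using cell_step expandI by (intro image_eqI[of _ _ "S d z"]) auto
  qed
  have inj: "inj_on g (truncate a b ` \<Delta> \<times> cell (a - 1) (b - 1) ` X)"
  proof (rule inj_onI)
    fix p p' assume p: "p \<in> truncate a b ` \<Delta> \<times> cell (a - 1) (b - 1) ` X"
      "p' \<in> truncate a b ` \<Delta> \<times> cell (a - 1) (b - 1) ` X" and g: "g p = g p'"
    have rng: "0 \<le> fst u \<and> fst u < M \<and> 0 \<le> snd u \<and> snd u < N" if "u \<in> truncate a b ` \<Delta>" for u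
      using that \<Delta> by (auto simp: truncate_def M_def N_def)
    obtain u v u' v' where uv: "p = (u, v)" "p' = (u', v')" by (cases p, cases p')
    have r: "0 \<le> fst u" "fst u < M" "0 \<le> snd u" "snd u < N" "0 \<le> fst u'" "fst u' < M" "0 \<le> snd u'" "snd u' < N"
      using p rng uv by auto
    have e: "M * fst v + fst u = M * fst v' + fst u'" "N * snd v + snd u = N * snd v' + snd u'"
      using g uv by (auto simp: g_def)
    from digit_unique[OF e(1) r(1,2,5,6)] digit_unique[OF e(2) r(3,4,7,8)] uv
    show "p = p'" by (simp add: prod_eq_iff)
  qed
  show ?thesis unfolding eq card_image[OF inj] by (rule card_cartesian_product)
qed

text \<open>The count is a product with one factor per letter, hence monotone in each factor. The
  levels a and b change along the induction, so the hypotheses are required at all levels; in return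
  all scales are compared at once.\<close>

lemma card_cells_funpow_mono:
  assumes "\<Delta> \<subseteq> all_digits" "\<Delta>' \<subseteq> all_digits"
    and "\<And>a b. card (truncate a b ` \<Delta>) \<le> card (truncate a b ` \<Delta>')"
    and "\<And>a b. card (cell a b ` X) \<le> card (cell a b ` Y)"
  shows "card (cell a b ` (expand \<Delta> ^^ q) X) \<le> card (cell a b ` (expand \<Delta>' ^^ q) Y)"
  by (induction q arbitrary: a b) (auto simp: card_cells_expand assms intro!: mult_mono)

lemma card_expand_funpow:
  assumes "\<Delta> \<subseteq> all_digits"
  shows "card ((expand \<Delta> ^^ q) X) = card \<Delta> ^ q * card X"
proof (induction q)
  case (Suc q)
  \<comment> \<open>At level (0, 0) cells are points, so the product formula counts the block
    itself.\<close>
  have id: "cell 0 0 ` Z = Z" "truncate 0 0 ` Z = Z" for Z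
    by (auto simp: cell_def truncate_def image_iff)
  have "card (expand \<Delta> Z) = card \<Delta> * card Z" for Z
    using card_cells_expand[OF assms, of 0 0 Z] by (simp add: id)
  with Suc show ?case by simp
qed simp

text \<open>A cell splits into at most \<open>m * n\<close> cells of the next finer level, indexed
  by remainders. This pays for rounding r to powers of m and n.\<close>

lemma card_cells_refine:
  assumes "finite A"
  shows "card (cell a b ` A) \<le> nat (m * n) * card (cell (Suc a) (Suc b) ` A)"
proof -
  let ?g = "\<lambda>u :: int \<times> int. ((fst u div m, snd u div n), (fst u mod m, snd u mod n))"
  have inj: "inj ?g"
    by (rule injI) (auto simp: prod_eq_iff, (metis div_mult_mod_eq)+)
  have "card (cell a b ` A) = card (?g ` cell a b ` A)"
    by (rule card_image[symmetric]) (rule inj_on_subset[OF inj], simp)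
  also have "\<dots> \<le> card (cell (Suc a) (Suc b) ` A \<times> ({0..<m} \<times> {0..<n}))"
  proof (rule card_mono)
    show "?g ` cell a b ` A \<subseteq> cell (Suc a) (Suc b) ` A \<times> ({0..<m} \<times> {0..<n})"
    proof (clarsimp simp: image_iff m_n_ge)
      fix x y assume "(x, y) \<in> A"
      have "fst (cell a b (x, y)) div m = fst (cell (Suc a) (Suc b) (x, y))"
        "snd (cell a b (x, y)) div n = snd (cell (Suc a) (Suc b) (x, y))"
        using m_n_ge by (simp_all add: cell_def mult.commute[of m] mult.commute[of n] flip: zdiv_zmult2_eq)
      then show "\<exists>z\<in>A. (fst (cell a b (x, y)) div m, snd (cell a b (x, y)) div n) = cell (Suc a) (Suc b) z"
        using \<open>(x, y) \<in> A\<close> by (intro bexI[of _ "(x, y)"]) auto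
    qed
  qed (use assms in auto)
  also have "\<dots> = nat (m * n) * card (cell (Suc a) (Suc b) ` A)"
    using m_n_ge by (simp add: card_cartesian_product nat_mult_distrib)
  finally show ?thesis .
qed

section \<open>Cells versus packings by squares\<close>

lemma square_disjointI:
  assumes "r < \<bar>real_of_int (fst a - fst b)\<bar> \<or> r < \<bar>real_of_int (snd a - snd b)\<bar>"
  shows "square r (emb a) \<inter> square r (emb b) = {}"
  using assms by (auto simp: square_def emb_def)

lemma square_disjointD:
  assumes "square r (emb a) \<inter> square r (emb b) = {}" "r \<ge> 0"
  shows "r < \<bar>real_of_int (fst a - fst b)\<bar> \<or> r < \<bar>real_of_int (snd a - snd b)\<bar>"
proof (rule ccontr)
  assume far: "\<not> ?thesis"
  \<comment> \<open>The midpoint of the two centres lies in both squares as soon as neither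
    coordinate differs by more than r.\<close>
  let ?c = "((real_of_int (fst a) + real_of_int (fst b)) / 2, (real_of_int (snd a) + real_of_int (snd b)) / 2)"
  have "?c \<in> square r (emb a) \<inter> square r (emb b)"
    using far assms(2) by (auto simp: square_def emb_def field_simps abs_if split: if_splits)
  with assms(1) show False by blast
qed

lemma abs_diff_less_of_div_eq:
  fixes x y M :: int
  assumes "x div M = y div M" "M > 0"
  shows "\<bar>x - y\<bar> < M"
proof -
  have "x - y = x mod M - y mod M"
    using assms(1) by (metis add_diff_cancel_left mult_div_mod_eq)
  moreover have "0 \<le> x mod M" "x mod M < M" "0 \<le> y mod M" "y mod M < M" using assms(2) by auto
  ultimately show ?thesis by linarith
qed

text \<open>Distinct indices of equal parity differ by at least 2, which leaves a whole cell in
  between. Disjointness of closed squares requires the strict inequality.\<close>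

lemma less_abs_diff_of_div:
  fixes x y M :: int
  assumes "x div M \<noteq> y div M" "even (x div M) = even (y div M)" "M > 0"
  shows "M < \<bar>x - y\<bar>"
proof -
  have "\<bar>u - v\<bar> \<ge> 2" if "u \<noteq> v" "even u = even v" for u v :: int
    using that by presburger
  then have "\<bar>x div M - y div M\<bar> \<ge> 2" using assms by blast
  then have "M * 2 \<le> M * \<bar>x div M - y div M\<bar>" using assms by (intro mult_left_mono) auto
  also have "\<dots> = \<bar>M * (x div M) - M * (y div M)\<bar>"
    using assms by (simp add: abs_mult flip: right_diff_distrib)
  also have "M * (x div M) - M * (y div M) = (x - y) - (x mod M - y mod M)"
    by (simp add: minus_mod_eq_mult_div[symmetric])
  finally have "2 * M \<le> \<bar>(x - y) - (x mod M - y mod M)\<bar>" by simp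
  moreover have "0 \<le> x mod M" "x mod M < M" "0 \<le> y mod M" "y mod M < M" using assms(3) by auto
  ultimately show ?thesis by linarith
qed

text \<open>Points of one cell differ by less than r in both coordinates, so their squares meet;
  disjoint squares have centres in different cells.\<close>

lemma packing_number_le_cells:
  assumes "finite A" "real_of_int (m ^ a) \<le> r" "real_of_int (n ^ b) \<le> r"
  shows "packing_number r A \<le> card (cell a b ` A)"
proof -
  obtain T where T: "T \<subseteq> A" "disjoint_family_on (\<lambda>a. square r (emb a)) T" "packing_number r A = card T"
    using packing_number_attained[OF assms(1)] .
  have pos: "m ^ a > 0" "n ^ b > 0" using m_n_ge by auto
  have r: "r \<ge> 0" using assms(2) pos(1) by (meson of_int_0_le_iff order_less_imp_le order_trans)
  have "inj_on (cell a b) T"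
  proof (rule inj_onI, rule ccontr)
    fix z w assume zw: "z \<in> T" "w \<in> T" "cell a b z = cell a b w" "z \<noteq> w"
    then have "square r (emb z) \<inter> square r (emb w) = {}"
      using T(2) by (auto simp: disjoint_family_on_def)
    from square_disjointD[OF this r]
    have far: "r < \<bar>real_of_int (fst z - fst w)\<bar> \<or> r < \<bar>real_of_int (snd z - snd w)\<bar>" .
    have "\<bar>fst z - fst w\<bar> < m ^ a" "\<bar>snd z - snd w\<bar> < n ^ b"
      using zw(3) pos by (auto simp: cell_def intro: abs_diff_less_of_div_eq)
    then have "real_of_int \<bar>fst z - fst w\<bar> < real_of_int (m ^ a)"
      "real_of_int \<bar>snd z - snd w\<bar> < real_of_int (n ^ b)" by (simp_all only: of_int_less_iff)
    with far assms(2,3) show False by auto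
  qed
  then have "card T = card (cell a b ` T)" by (simp add: card_image)
  also have "\<dots> \<le> card (cell a b ` A)" using T(1) assms(1) by (intro card_mono image_mono) auto
  finally show ?thesis using T(3) by simp
qed

text \<open>Representatives of distinct cells are far apart once the cell indices are restricted to a
  fixed parity class; there are four such classes.\<close>

lemma cells_le_packing_number:
  assumes "finite A" "r \<le> real_of_int (m ^ a)" "r \<le> real_of_int (n ^ b)"
  shows "card (cell a b ` A) \<le> 4 * packing_number r A"
proof -
  let ?par = "\<lambda>u :: int \<times> int. (even (fst u), even (snd u))"
  have pos: "m ^ a > 0" "n ^ b > 0" using m_n_ge by auto
  have parity_class: "card {u \<in> cell a b ` A. ?par u = p} \<le> packing_number r A" for p
  proof -
    let ?U = "{u \<in> cell a b ` A. ?par u = p}"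
    define rep where "rep = inv_into A (cell a b)"
    have rep: "rep u \<in> A" "cell a b (rep u) = u" if "u \<in> ?U" for u
      using that unfolding rep_def by (auto intro: inv_into_into f_inv_into_f)
    have "inj_on rep ?U" by (metis (no_types, lifting) inj_onI rep(2))
    then have "card ?U = card (rep ` ?U)" by (simp add: card_image)
    also have "\<dots> \<le> packing_number r A"
    proof (rule packing_number_ge[OF assms(1)])
      show "rep ` ?U \<subseteq> A" using rep by blast
      show "disjoint_family_on (\<lambda>a. square r (emb a)) (rep ` ?U)"
        unfolding disjoint_family_on_def
      proof (intro ballI impI)
        fix z w assume zw: "z \<in> rep ` ?U" "w \<in> rep ` ?U" "z \<noteq> w"
        obtain u v where u: "u \<in> ?U" "z = rep u" and v: "v \<in> ?U" "w = rep v"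
          using zw(1,2) by blast
        then have c: "cell a b z = u" "cell a b w = v" using rep(2) by simp_all
        have par: "?par (cell a b z) = ?par (cell a b w)" using u(1) v(1) unfolding c by simp
        have ne: "cell a b z \<noteq> cell a b w" using zw(3) u v unfolding c by blast
        from ne consider "fst z div m ^ a \<noteq> fst w div m ^ a" | "snd z div n ^ b \<noteq> snd w div n ^ b"
          by (auto simp: cell_def)
        then have "m ^ a < \<bar>fst z - fst w\<bar> \<or> n ^ b < \<bar>snd z - snd w\<bar>"
          by cases (use par pos less_abs_diff_of_div in \<open>auto simp: cell_def\<close>)
        then have "real_of_int (m ^ a) < real_of_int \<bar>fst z - fst w\<bar>
          \<or> real_of_int (n ^ b) < real_of_int \<bar>snd z - snd w\<bar>" by (simp only: of_int_less_iff)
        then show "square r (emb z) \<inter> square r (emb w) = {}"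
          using assms(2,3) by (intro square_disjointI) auto
      qed
    qed
    finally show ?thesis .
  qed
  have "cell a b ` A = (\<Union>p\<in>UNIV. {u \<in> cell a b ` A. ?par u = p})" by auto
  then have "card (cell a b ` A) = card (\<Union>p\<in>UNIV. {u \<in> cell a b ` A. ?par u = p})"
    by (rule arg_cong)
  also have "\<dots> \<le> (\<Sum>p\<in>UNIV. card {u \<in> cell a b ` A. ?par u = p})"
    by (rule card_UN_le) simp
  also have "\<dots> \<le> (\<Sum>p\<in>(UNIV :: (bool \<times> bool) set). packing_number r A)"
    by (intro sum_mono parity_class)
  also have "\<dots> = 4 * packing_number r A" by (simp add: card_prod)
  finally show ?thesis .
qed

section \<open>Orbits of the corner points\<close>

definition corners :: "(int \<times> int) set" where
  "corners = {-1, 0} \<times> {-1, 0}"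

text \<open>The unique solution d of \<open>S d z = z\<close>: for a corner, coordinate 0 gets the
  digit 0 and coordinate -1 the largest digit.\<close>

definition corner_digit :: "int \<times> int \<Rightarrow> int \<times> int" where
  "corner_digit z = (- (m - 1) * fst z, - (n - 1) * snd z)"

text \<open>These are the letters of \<Lambda> whose maps fix the first coordinate of z.\<close>

definition column :: "int \<times> int \<Rightarrow> (int \<times> int) set" where
  "column z = {d \<in> \<Lambda>. fst d = fst (corner_digit z)}"

definition same_signs :: "int \<times> int \<Rightarrow> int \<times> int \<Rightarrow> bool" where
  "same_signs z w \<longleftrightarrow> (0 \<le> fst w \<longleftrightarrow> 0 \<le> fst z) \<and> (0 \<le> snd w \<longleftrightarrow> 0 \<le> snd z)"

lemma finite_corners: "finite corners"
  by (simp add: corners_def)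

lemma bar_corner: "z \<in> corners \<Longrightarrow> bar (fst z) = 0 \<and> bar (snd z) = 0"
  by (auto simp: corners_def bar_def)

lemma corner_eqI:
  assumes "z \<in> corners" "same_signs z w" "bar (fst w) < 1" "bar (snd w) < 1"
  shows "w = z"
  using assms by (auto simp: corners_def same_signs_def bar_def prod_eq_iff split: if_splits)

lemma S_corner_digit: "S (corner_digit z) z = z"
  by (simp add: affine_map_def corner_digit_def prod_eq_iff algebra_simps)

lemma fixed_digit_eq: "S d z = z \<Longrightarrow> d = corner_digit z"
  by (simp add: affine_map_def corner_digit_def prod_eq_iff algebra_simps)

lemma corner_digit_range: "z \<in> corners \<Longrightarrow> corner_digit z \<in> all_digits"
  using m_n_ge by (auto simp: corners_def corner_digit_def)

lemma corner_digit_inj: "corner_digit z = corner_digit w \<Longrightarrow> z = w"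
  using m_n_ge by (auto simp: corner_digit_def prod_eq_iff)

lemma column_digits: "column z \<subseteq> all_digits"
  using digits by (auto simp: column_def)

lemma finite_column: "finite (column z)"
  using column_digits by (rule finite_digits)

lemma finite_\<Lambda>: "finite \<Lambda>"
  using digits by (rule finite_digits)

lemma corner_digit_in_column: "corner_digit z \<in> \<Lambda> \<Longrightarrow> corner_digit z \<in> column z"
  by (simp add: column_def)

lemma bar_S:
  assumes "d \<in> all_digits"
  shows "bar (fst (S d z)) = m * bar (fst z) + rel_digit m (fst z) (fst d)"
    "bar (snd (S d z)) = n * bar (snd z) + rel_digit n (snd z) (snd d)"
  using digitD[OF assms] by (simp_all add: affine_map_def bar_step)

lemma same_signs_S: "d \<in> all_digits \<Longrightarrow> same_signs z (S d w) \<longleftrightarrow> same_signs z w"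
  using digitD[of d] by (simp add: same_signs_def affine_map_def sign_step)

lemma bar_S_less:
  assumes "d \<in> all_digits"
  shows "bar (fst (S d z)) < m ^ Suc q \<Longrightarrow> bar (fst z) < m ^ q"
    "bar (snd (S d z)) < n ^ Suc q \<Longrightarrow> bar (snd z) < n ^ q"
  using digitD[OF assms] bar_less_step[of "fst d" m "fst z" q] bar_less_step[of "snd d" n "snd z" q]
  by (simp_all add: affine_map_def)

text \<open>An integer v below u' satisfies \<open>v + 1 \<le> u'\<close>, which leaves room for one
  more digit. Half-open bounds therefore scale exactly, without accumulating errors.\<close>

lemma bar_expand_bounds:
  assumes "w \<in> (expand \<Delta> ^^ q) X" "\<Delta> \<subseteq> all_digits"
    and "\<And>z. z \<in> X \<Longrightarrow> x \<le> bar (fst z) \<and> bar (fst z) < x' \<and> y \<le> bar (snd z) \<and> bar (snd z) < y'"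
  shows "m ^ q * x \<le> bar (fst w) \<and> bar (fst w) < m ^ q * x' \<and>
    n ^ q * y \<le> bar (snd w) \<and> bar (snd w) < n ^ q * y'"
  using assms(1)
proof (induction q arbitrary: w)
  case (Suc q)
  have step: "M * u \<le> M * v + i \<and> M * v + i < M * u'"
    if "u \<le> v" "v < u'" "0 \<le> i" "i < M" for M u v u' i :: int
  proof -
    have "M * u \<le> M * v" using that by (intro mult_left_mono) auto
    moreover have "M * (v + 1) \<le> M * u'" using that by (intro mult_left_mono) auto
    ultimately show ?thesis using that unfolding distrib_left mult_1_right by linarith
  qed
  from Suc.prems obtain d z where dz: "d \<in> \<Delta>" "z \<in> (expand \<Delta> ^^ q) X" "w = S d z"
    by (auto elim: expandE)
  then have d: "d \<in> all_digits" using assms(2) by blast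
  have r: "0 \<le> rel_digit m (fst z) (fst d)" "rel_digit m (fst z) (fst d) < m"
    "0 \<le> rel_digit n (snd z) (snd d)" "rel_digit n (snd z) (snd d) < n"
    using digitD[OF d] rel_digit_range by blast+
  from Suc.IH[OF dz(2)] have ih: "m ^ q * x \<le> bar (fst z)" "bar (fst z) < m ^ q * x'"
    "n ^ q * y \<le> bar (snd z)" "bar (snd z) < n ^ q * y'" by auto
  from step[OF ih(1,2) r(1,2)] step[OF ih(3,4) r(3,4)] show ?case
    unfolding dz(3) bar_S[OF d] by (simp add: mult.assoc)
qed (use assms(3) in simp)

lemma fst_expand_column:
  assumes "w \<in> (expand (column z) ^^ p) X" "\<And>v. v \<in> X \<Longrightarrow> fst v = fst z"
  shows "fst w = fst z"
  using assms(1)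
proof (induction p arbitrary: w)
  case (Suc p)
  from Suc.prems obtain d v where v: "d \<in> column z" "v \<in> (expand (column z) ^^ p) X" "w = S d v"
    by (auto elim: expandE)
  with Suc.IH have "fst v = fst z" by blast
  with v show ?case
    using S_corner_digit[of z] by (simp add: column_def affine_map_def prod_eq_iff)
qed (use assms(2) in simp)

lemma invariantE:
  assumes "invariant_set m n \<Lambda> X" "w \<in> X"
  obtains d v where "d \<in> \<Lambda>" "v \<in> X" "w = S d v"
  using assms unfolding invariant_set_def by blast

lemma invariant_closed:
  assumes "invariant_set m n \<Lambda> X" "d \<in> \<Lambda>" "w \<in> X"
  shows "S d w \<in> X"
  using assms unfolding invariant_set_def by blast

text \<open>The inverse branches are followed inward. After q of them the first coordinate has
  reached that of z and can only stay there, which forces the remaining p letters into the column.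
  The walk ends at z because z is the only corner in its quadrant.\<close>

lemma bounded_part_subset:
  assumes inv: "invariant_set m n \<Lambda> X" and z: "z \<in> corners"
    and signs: "\<And>w. w \<in> X \<Longrightarrow> same_signs z w"
    and w: "w \<in> X" "bar (fst w) < m ^ q" "bar (snd w) < n ^ (q + p)"
  shows "w \<in> (expand \<Lambda> ^^ q) ((expand (column z) ^^ p) {z})"
  using w
proof (induction q arbitrary: w)
  case 0
  then have "fst w = fst z" "bar (snd w) < n ^ p"
    using z signs[of w] by (auto simp: corners_def same_signs_def bar_def split: if_splits)
  with \<open>w \<in> X\<close> have "w \<in> (expand (column z) ^^ p) {z}"
  proof (induction p arbitrary: w)
    case 0
    then show ?case
      using corner_eqI[OF z, of w] signs[of w] bar_corner[OF z] by simp
  next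
    case (Suc p)
    obtain d v where d: "d \<in> \<Lambda>" and v: "v \<in> X" "w = S d v"
      using invariantE[OF inv \<open>w \<in> X\<close>] .
    then have d': "d \<in> all_digits" using digits by blast
    have "m * fst v + fst d = m * fst z + fst (corner_digit z)"
      using Suc.prems(2) S_corner_digit[of z] v by (simp add: affine_map_def prod_eq_iff)
    then have eq: "fst v = fst z \<and> fst d = fst (corner_digit z)"
      using digitD[OF d'] digitD[OF corner_digit_range[OF z]] by (intro digit_unique) auto
    then have "v \<in> (expand (column z) ^^ p) {z}"
      using v Suc.prems(3) bar_S_less(2)[OF d'] by (intro Suc.IH) auto
    moreover have "d \<in> column z" using d eq by (simp add: column_def)
    ultimately show ?case unfolding v(2) by (simp add: expandI)
  qed
  then show ?case by simp
next
  case (Suc q)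
  obtain d v where d: "d \<in> \<Lambda>" and v: "v \<in> X" "w = S d v"
    using invariantE[OF inv \<open>w \<in> X\<close>] .
  then have d': "d \<in> all_digits" using digits by blast
  have "v \<in> (expand \<Lambda> ^^ q) ((expand (column z) ^^ p) {z})"
    using Suc.prems(2,3) v bar_S_less[OF d'] by (intro Suc.IH) auto
  with d show ?case unfolding v(2) by (simp add: expandI)
qed

section \<open>Forward orbits of fixed corners\<close>

lemma word_map_simps: "word_map m n [] = id" "word_map m n (d # ds) = S d \<circ> word_map m n ds"
  by (simp_all add: word_map_def)

abbreviation orbit where "orbit \<equiv> forward_orbit m n \<Lambda>"

lemma orbitE:
  assumes "w \<in> orbit z" obtains ds where "ds \<in> lists \<Lambda>" "w = word_map m n ds z"
  using assms by (auto simp: forward_orbit_def)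

lemma orbit_closed:
  assumes "w \<in> orbit z" "d \<in> \<Lambda>"
  shows "S d w \<in> orbit z"
proof -
  obtain ds where "ds \<in> lists \<Lambda>" "w = word_map m n ds z" using assms(1) by (rule orbitE)
  then have "S d w = word_map m n (d # ds) z" "d # ds \<in> lists \<Lambda>"
    using assms(2) by (simp_all add: word_map_simps)
  then show ?thesis unfolding forward_orbit_def by fastforce
qed

lemma corner_in_orbit:
  assumes "corner_digit z \<in> \<Lambda>"
  shows "z \<in> orbit z"
proof -
  have "z = word_map m n [corner_digit z] z" by (simp add: word_map_simps S_corner_digit)
  with assms show ?thesis unfolding forward_orbit_def by fastforce
qed

lemma corner_periodic:
  assumes "corner_digit z \<in> \<Lambda>"
  shows "z \<in> periodic_points m n \<Lambda>"
proof -
  have "word_map m n [corner_digit z] z = z" by (simp add: word_map_simps S_corner_digit)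
  with assms show ?thesis
    unfolding periodic_points_def by (intro CollectI exI[of _ "[corner_digit z]"]) simp
qed

lemma orbit_subset:
  assumes "z \<in> X" "\<And>d w. d \<in> \<Lambda> \<Longrightarrow> w \<in> X \<Longrightarrow> S d w \<in> X"
  shows "orbit z \<subseteq> X"
proof
  fix w assume "w \<in> orbit z"
  then obtain ds where ds: "ds \<in> lists \<Lambda>" "w = word_map m n ds z" by (rule orbitE)
  have "word_map m n ds z \<in> X" using ds(1)
    by (induction ds) (auto simp: word_map_simps assms)
  with ds show "w \<in> X" by simp
qed

text \<open>Removing the last applied letter from a word of length one leaves the empty word, whose
  value z lies in the orbit only because z is fixed by its corner digit.\<close>

lemma invariant_orbit:
  assumes "corner_digit z \<in> \<Lambda>"
  shows "invariant_set m n \<Lambda> (orbit z)"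
proof -
  have "orbit z \<subseteq> (\<Union>d\<in>\<Lambda>. S d ` orbit z)"
  proof
    fix w assume "w \<in> orbit z"
    then obtain ds where ds: "ds \<in> lists \<Lambda>" "w = word_map m n ds z" "length ds \<ge> 1"
      unfolding forward_orbit_def by blast
    then obtain d es where e: "ds = d # es" by (cases ds) auto
    have "word_map m n es z \<in> orbit z"
    proof (cases es)
      case Nil
      then show ?thesis using corner_in_orbit[OF assms] by (simp add: word_map_simps)
    next
      case (Cons e' es')
      then show ?thesis using ds(1) unfolding e forward_orbit_def by fastforce
    qed
    then show "w \<in> (\<Union>d\<in>\<Lambda>. S d ` orbit z)"
      using ds(1,2) unfolding e by (auto simp: word_map_simps)
  qed
  then show ?thesis
    unfolding invariant_set_def using corner_in_orbit[OF assms] orbit_closed by blast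
qed

lemma same_signs_orbit: "w \<in> orbit z \<Longrightarrow> same_signs z w"
proof -
  have "orbit z \<subseteq> {w. same_signs z w}"
    by (rule orbit_subset) (use digits in \<open>auto simp: same_signs_S subset_iff, simp add: same_signs_def\<close>)
  then show "w \<in> orbit z \<Longrightarrow> same_signs z w" by blast
qed

lemma expand_column_funpow_subset_orbit:
  assumes "Y \<subseteq> orbit z"
  shows "(expand \<Lambda> ^^ q) ((expand (column z') ^^ p) Y) \<subseteq> orbit z"
proof -
  have "expand \<Lambda> (orbit z) \<subseteq> orbit z" by (auto elim!: expandE intro: orbit_closed)
  moreover have "expand (column z') (orbit z) \<subseteq> orbit z"
    by (auto elim!: expandE intro: orbit_closed simp: column_def)
  ultimately show ?thesis using assms by (intro expand_funpow_subset)
qed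

section \<open>The mass dimension of an orbit\<close>

text \<open>With \<open>m ^ q\<close> and \<open>n ^ (q + p)\<close> the largest powers not
  exceeding h, the window lies between two digit blocks that differ by one free letter. This
  determines its count up to the factor \<open>card \<Lambda>\<close>.\<close>

lemma has_mass_dim_orbit:
  assumes z: "z \<in> corners" and cd: "corner_digit z \<in> \<Lambda>"
  shows "\<exists>L. has_mass_dim (orbit z) L"
proof -
  define N where "N = real (card \<Lambda>)"
  define R where "R = real (card (column z))"
  have "card (column z) > 0"
    using corner_digit_in_column[OF cd] finite_column by (auto simp: card_gt_0_iff)
  then have R1: "R \<ge> 1" by (simp add: R_def)
  have RN: "R \<le> N"
    unfolding R_def N_def by (intro of_nat_mono card_mono finite_\<Lambda>) (auto simp: column_def)
  define block where "block = (\<lambda>q p. (expand \<Lambda> ^^ q) ((expand (column z) ^^ p) {z}))"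
  have card_block: "real (card (block q p)) = N ^ q * R ^ p" for q p
    unfolding block_def N_def R_def
    by (simp add: card_expand_funpow digits column_digits)
  have finite_block: "finite (block q p)" for q p
    unfolding block_def by (intro finite_expand_funpow digits column_digits) simp
  \<comment> \<open>A block has \<open>N ^ q * R ^ p = (N / R) ^ q * R ^ (q + p)\<close> points,
    where q is close to \<open>ln h / ln m\<close> and \<open>q + p\<close> to
    \<open>ln h / ln n\<close>.\<close>
  define L where "L = (ln N - ln R) / ln m + ln R / ln n"
  let ?W = "\<lambda>h. {a \<in> orbit z. emb a - 0 \<in> {-h..h} \<times> {-h..h}}"
  have bounds: "window_count (orbit z) 0 h > 0 \<and>
      \<bar>ln (real (window_count (orbit z) 0 h)) - L * ln h\<bar> \<le> ln N" if h: "h > 1" for h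
  proof -
    have m1: "real_of_int m > 1" "real_of_int n > 1" using m_n_ge by auto
    obtain q where q: "real_of_int m ^ q \<le> h" "h < real_of_int m ^ Suc q"
      using ex_power_bracket[of "real_of_int m" h] m1 h by auto
    obtain l where l: "real_of_int n ^ l \<le> h" "h < real_of_int n ^ Suc l"
      using ex_power_bracket[of "real_of_int n" h] m1 h by auto
    have "real_of_int n ^ q \<le> real_of_int m ^ q"
      using n_le_m m_n_ge by (intro power_mono) auto
    with q(1) l(2) have "real_of_int n ^ q < real_of_int n ^ Suc l" by linarith
    then have ql: "q \<le> l" using m1 by (simp only: power_strict_increasing_iff less_Suc_eq_le)
    then obtain p where p: "l = q + p" using le_iff_add by blast
    have lower: "block q p \<subseteq> ?W h"
    proof
      fix w assume w: "w \<in> block q p"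
      have "block q p \<subseteq> orbit z"
        unfolding block_def by (intro expand_column_funpow_subset_orbit) (simp add: corner_in_orbit cd)
      with w have wO: "w \<in> orbit z" by blast
      have col: "0 \<le> bar (fst v) \<and> bar (fst v) < 1 \<and> 0 \<le> bar (snd v) \<and> bar (snd v) < n ^ p"
        if v: "v \<in> (expand (column z) ^^ p) {z}" for v
        using bar_expand_bounds[OF v column_digits, of 0 1 0 1] fst_expand_column[OF v]
          bar_corner[OF z] by (auto simp: bar_nonneg)
      have "bar (fst w) < m ^ q * 1" "bar (snd w) < n ^ q * n ^ p"
        using bar_expand_bounds[OF w[unfolded block_def] digits col] by auto
      \<comment> \<open>The absolute value may exceed the bar by one, but a strict bound on the bar
        becomes a weak bound, and the window is closed.\<close>
      then have "\<bar>fst w\<bar> \<le> m ^ q" "\<bar>snd w\<bar> \<le> n ^ l"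
        using bar_le_abs(2)[of "fst w"] bar_le_abs(2)[of "snd w"] unfolding p power_add by linarith+
      then have "real_of_int \<bar>fst w\<bar> \<le> real_of_int (m ^ q)" "real_of_int \<bar>snd w\<bar> \<le> real_of_int (n ^ l)"
        by (simp_all only: of_int_le_iff)
      then have "\<bar>real_of_int (fst w)\<bar> \<le> h" "\<bar>real_of_int (snd w)\<bar> \<le> h" using q(1) l(1) by auto
      then show "w \<in> ?W h" using wO by (auto simp: emb_def)
    qed
    \<comment> \<open>One extra free letter suffices in both coordinates, since
      \<open>Suc q + p = Suc l\<close>.\<close>
    have upper: "?W h \<subseteq> block (Suc q) p"
    proof
      fix w assume w: "w \<in> ?W h"
      then have h': "real_of_int \<bar>fst w\<bar> \<le> h" "real_of_int \<bar>snd w\<bar> \<le> h"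
        by (auto simp: emb_def)
      have "real_of_int \<bar>fst w\<bar> < real_of_int (m ^ Suc q)" "real_of_int \<bar>snd w\<bar> < real_of_int (n ^ (Suc q + p))"
        using h' q(2) l(2) unfolding p by simp_all
      then have "\<bar>fst w\<bar> < m ^ Suc q" "\<bar>snd w\<bar> < n ^ (Suc q + p)"
        by (simp_all only: of_int_less_iff)
      then have "bar (fst w) < m ^ Suc q" "bar (snd w) < n ^ (Suc q + p)"
        using bar_le_abs(1)[of "fst w"] bar_le_abs(1)[of "snd w"] by linarith+
      then show "w \<in> block (Suc q) p"
        unfolding block_def
        using w by (intro bounded_part_subset[OF invariant_orbit[OF cd] z same_signs_orbit]) auto
    qed
    define c where "c = real (window_count (orbit z) 0 h)"
    have "card (block q p) \<le> card (?W h)" using lower by (intro card_mono finite_window)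
    then have c1: "N ^ q * R ^ p \<le> c"
      unfolding card_block[symmetric] c_def window_count_def by simp
    have "card (?W h) \<le> card (block (Suc q) p)" using upper by (intro card_mono finite_block)
    then have c2: "c \<le> N ^ Suc q * R ^ p"
      unfolding card_block[symmetric] c_def window_count_def by simp
    have N0: "N > 0" "R > 0" using R1 RN by auto
    then have pos: "N ^ q * R ^ p > 0" by simp
    with c1 have c0: "c > 0" by linarith
    have lnc1: "real q * (ln N - ln R) + real l * ln R \<le> ln c"
    proof -
      have "ln (N ^ q * R ^ p) \<le> ln c" using c1 pos by (intro ln_mono)
      then show ?thesis using N0 by (simp add: ln_mult ln_realpow p algebra_simps)
    qed
    have lnc2: "ln c \<le> real q * (ln N - ln R) + real l * ln R + ln N"
    proof -
      have "ln c \<le> ln (N ^ Suc q * R ^ p)" using c0 c2 by (intro ln_mono)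
      then show ?thesis using N0 by (simp add: ln_mult ln_realpow p algebra_simps)
    qed
    have lnm: "ln (real_of_int m) > 0" "ln (real_of_int n) > 0" using m1 by auto
    have qh: "real q \<le> ln h / ln m" "ln h / ln m \<le> real q + 1"
    proof -
      have "ln (real_of_int m ^ q) \<le> ln h" "ln h \<le> ln (real_of_int m ^ Suc q)"
        using q h m1 by (auto intro!: ln_mono)
      then have "real q * ln m \<le> ln h" "ln h \<le> real (Suc q) * ln m"
        using m1 by (simp_all only: ln_realpow)
      then show "real q \<le> ln h / ln m" "ln h / ln m \<le> real q + 1"
        using lnm by (simp_all add: field_simps)
    qed
    have lh: "real l \<le> ln h / ln n" "ln h / ln n \<le> real l + 1"
    proof -
      have "ln (real_of_int n ^ l) \<le> ln h" "ln h \<le> ln (real_of_int n ^ Suc l)"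
        using l h m1 by (auto intro!: ln_mono)
      then have "real l * ln n \<le> ln h" "ln h \<le> real (Suc l) * ln n"
        using m1 by (simp_all only: ln_realpow)
      then show "real l \<le> ln h / ln n" "ln h / ln n \<le> real l + 1"
        using lnm by (simp_all add: field_simps)
    qed
    have d: "ln N - ln R \<ge> 0" "ln R \<ge> 0" using RN R1 by auto
    have Lh: "L * ln h = ln h / ln m * (ln N - ln R) + ln h / ln n * ln R"
      by (simp add: L_def algebra_simps)
    have "real q * (ln N - ln R) + real l * ln R \<le> L * ln h"
      unfolding Lh using qh lh d by (intro add_mono mult_right_mono)
    moreover have "L * ln h \<le> (real q + 1) * (ln N - ln R) + (real l + 1) * ln R"
      unfolding Lh using qh lh d by (intro add_mono mult_right_mono)
    \<comment> \<open>The extra letter costs \<open>ln N\<close> on one side. On the other, rounding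
      q and l costs \<open>ln N - ln R\<close> and \<open>ln R\<close>, again \<open>ln N\<close> in
      total.\<close>
    ultimately have "\<bar>ln c - L * ln h\<bar> \<le> ln N"
      using lnc1 lnc2 by (simp add: algebra_simps)
    then show ?thesis using c0 by (simp add: c_def)
  qed
  then have "has_mass_dim (orbit z) L" by (intro has_mass_dimI[where c = "ln N"]) auto
  then show ?thesis by blast
qed

section \<open>Copies of digit blocks inside a single shell\<close>

text \<open>If \<open>2 ^ i \<le> G < 2 ^ Suc i\<close>, then \<open>2 ^ Suc i\<close> is the only
  power of two that can separate points of gauge between G and 2 * G. Either Y1 lies entirely below
  it, or Y2 entirely above.\<close>

lemma ex_single_shell:
  assumes Y1: "\<And>w. w \<in> Y1 \<Longrightarrow> G \<le> gauge w \<and> gauge w < G'"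
    and Y2: "\<And>w. w \<in> Y2 \<Longrightarrow> G' \<le> gauge w \<and> gauge w < 2 * G"
    and G: "2 ^ j \<le> G" "2 * G \<le> 2 ^ (j + c)"
  shows "\<exists>k'. j + 2 \<le> k' \<and> k' \<le> j + 2 + c \<and> (Y1 \<subseteq> shell k' \<or> Y2 \<subseteq> shell k')"
proof -
  have "1 \<le> G" using G(1) one_le_power[of "2::int" j] by linarith
  then obtain i where i: "2 ^ i \<le> G" "G < 2 ^ Suc i"
    using ex_power_bracket_int[of 2 G] by auto
  have "(2::int) ^ j < 2 ^ Suc i" using i G by linarith
  then have ji: "j \<le> i" by (simp only: power_strict_increasing_iff less_Suc_eq_le)
  have "(2::int) ^ Suc i \<le> 2 ^ (j + c)" using i G by simp
  then have ic: "Suc i \<le> j + c" by (simp only: power_increasing_iff)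
  show ?thesis
  proof (cases "2 ^ Suc i \<ge> G'")
    case True
    have "Y1 \<subseteq> shell (i + 2)"
      unfolding shell_iff_gauge subset_iff using Y1 i True by force
    then show ?thesis using ji ic by (intro exI[of _ "i + 2"]) simp
  next
    case False
    have "Y2 \<subseteq> shell (Suc i + 2)"
      unfolding shell_iff_gauge subset_iff using Y2 i False by force
    then show ?thesis using ji ic by (intro exI[of _ "Suc i + 2"]) simp
  qed
qed

text \<open>First entries agree within a column. Truncation is thus injective on it while the second
  entry is visible and constant otherwise, so the count is the column size or 1.\<close>

lemma card_truncate_column_le:
  assumes "corner_digit z' \<in> \<Lambda>" "card (column z) \<le> card (column z')"
  shows "card (truncate a b ` column z) \<le> card (truncate a b ` column z')"
proof (cases "b = 0")
  case True
  have "inj_on (truncate a b) (column z')"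
    using True by (auto simp: inj_on_def truncate_def column_def prod_eq_iff)
  then show ?thesis
    using assms(2) card_image_le[OF finite_column, of "truncate a b" z] by (simp add: card_image)
next
  case False
  have "truncate a b ` column z \<subseteq> {(if a = 0 then fst (corner_digit z) else 0, 0)}"
    using False by (auto simp: truncate_def column_def)
  then have "card (truncate a b ` column z) \<le> 1"
    using card_mono[of "{(if a = 0 then fst (corner_digit z) else 0, 0)}"] by simp
  also have "1 \<le> card (truncate a b ` column z')"
    using corner_digit_in_column[OF assms(1)] finite_column
    by (simp add: Suc_le_eq card_gt_0_iff) blast
  finally show ?thesis .
qed

text \<open>The outward copies constructed below have gauge less than
  \<open>4 * m ^ 4 * 2 ^ j\<close> or \<open>4 * m ^ 3 * 2 ^ j\<close>; this bounds the number of
  additional doublings in both cases, independently of j.\<close>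

definition shift :: nat where
  "shift = nat (4 * m ^ 5)"

lemma shift_bound: "4 * m ^ 5 \<le> 2 ^ shift"
  using int_less_power[of 2 "4 * m ^ 5"] by (simp add: shift_def)

lemma shell_part_subset:
  assumes z: "z \<in> corners" and cd: "corner_digit z \<in> \<Lambda>"
    and q: "2 ^ Suc j \<le> m ^ q" "2 ^ Suc j \<le> n ^ (q + p)"
  shows "orbit z \<inter> shell (j + 2) \<subseteq> (expand \<Lambda> ^^ q) ((expand (column z) ^^ p) {z})"
proof
  fix w assume w: "w \<in> orbit z \<inter> shell (j + 2)"
  then have "gauge w < 2 ^ Suc j" using shell_iff_gauge by blast
  then have "bar (fst w) < m ^ q" "bar (snd w) < n ^ (q + p)"
    using q unfolding gauge_def by linarith+
  with w show "w \<in> (expand \<Lambda> ^^ q) ((expand (column z) ^^ p) {z})"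
    using same_signs_orbit by (intro bounded_part_subset[OF invariant_orbit[OF cd] z]) auto
qed

text \<open>Both powers exceed \<open>2 ^ Suc j\<close>, so a block of this size covers shell
  \<open>j + 2\<close>; the upper bounds keep it comparable to that shell. The vertical size
  strictly exceeds the horizontal one, so that a vertical push decides the gauge.\<close>

lemma ex_block_size:
  obtains q p where "2 ^ Suc j < m ^ q" "m ^ q \<le> m * 2 ^ Suc j"
    "m ^ q < n ^ (q + p)" "n ^ (q + p) \<le> n * m ^ q"
proof -
  have "(1::int) \<le> 2 ^ Suc j" by (rule one_le_power) simp
  with m_n_ge(4) obtain a where a: "m ^ a \<le> 2 ^ Suc j" "2 ^ Suc j < m ^ Suc a"
    by (rule ex_power_bracket_int)
  have "1 \<le> m ^ Suc a" using m_n_ge by (intro one_le_power) simp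
  with m_n_ge(5) obtain b where b: "n ^ b \<le> m ^ Suc a" "m ^ Suc a < n ^ Suc b"
    by (rule ex_power_bracket_int)
  have "n ^ Suc a \<le> m ^ Suc a" using n_le_m m_n_ge by (intro power_mono) auto
  with b have "n ^ Suc a < n ^ Suc b" by linarith
  then have "Suc a \<le> Suc b" using m_n_ge by (simp only: power_strict_increasing_iff less_imp_le)
  then obtain p where p: "Suc b = Suc a + p" using le_iff_add by blast
  show ?thesis
  proof (rule that[of "Suc a" p])
    show "m ^ Suc a \<le> m * 2 ^ Suc j" using a(1) m_n_ge by simp
    show "n ^ (Suc a + p) \<le> n * m ^ Suc a" using b(1) m_n_ge unfolding p[symmetric] by simp
  qed (use a b p in auto)
qed

text \<open>The prefix digit \<open>e\<close> pushes the block of \<open>z\<close> away from the origin. It is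
  applied once or twice, because one of the two resulting copies avoids the power of two separating
  consecutive shells.\<close>

lemma ex_copy_column:
  assumes z: "z \<in> corners" "corner_digit z \<in> \<Lambda>"
    and e: "e \<in> column z" "e \<noteq> corner_digit z"
  shows "\<exists>k' Y. j + 2 \<le> k' \<and> k' \<le> j + 2 + shift \<and> Y \<subseteq> orbit z \<inter> shell k' \<and>
    (\<forall>z' a b. z' \<in> corners \<and> corner_digit z' \<in> \<Lambda> \<and> card (column z') \<le> card (column z) \<longrightarrow>
      card (cell a b ` (orbit z' \<inter> shell (j + 2))) \<le> card (cell a b ` Y))"
proof -
  let ?c = "corner_digit z"
  obtain q p where q: "2 ^ Suc j < m ^ q" "m ^ q \<le> m * 2 ^ Suc j"
    and l: "m ^ q < n ^ (q + p)" "n ^ (q + p) \<le> n * m ^ q" by (rule ex_block_size)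
  define block where "block = (\<lambda>y. (expand \<Lambda> ^^ q) ((expand (column z) ^^ p) {y}))"
  have eL: "e \<in> \<Lambda>" and cD: "?c \<in> all_digits" and eD: "e \<in> all_digits" and fe: "fst e = fst ?c"
    using e digits corner_digit_range[OF z(1)] by (auto simp: column_def)
  \<comment> \<open>The second digit of e as seen from the quadrant of z, where that of the corner
    digit becomes 0. Since e shares the first entry of the corner digit, this value is
    nonzero.\<close>
  define \<eta> where "\<eta> = rel_digit n (snd z) (snd e)"
  have "snd e \<noteq> snd ?c" using e fe by (auto simp: prod_eq_iff)
  then have \<eta>: "1 \<le> \<eta>" "\<eta> \<le> n - 1"
    using z(1) digitD[OF eD] by (auto simp: \<eta>_def rel_digit_def corners_def corner_digit_def)
  have rc: "rel_digit n (snd z) (snd ?c) = 0"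
    using z(1) by (auto simp: rel_digit_def corners_def corner_digit_def)
  have signs: "same_signs z (S e z)" using eD by (simp add: same_signs_S) (simp add: same_signs_def)
  have rel: "rel_digit n (snd (S e z)) i = rel_digit n (snd z) i" for i
    using signs by (simp add: same_signs_def rel_digit_def)
  \<comment> \<open>Both points are two letters away from z, with second bars
    \<open>n * \<eta>\<close> and \<open>n * \<eta> + \<eta>\<close>. Padding the first one with the
    corner digit keeps their ratio below 2, so both blocks fit between G and 2 * G.\<close>
  define y1 where "y1 = S ?c (S e z)"
  define y2 where "y2 = S e (S e z)"
  have "fst (S e z) = fst z" using S_corner_digit[of z] fe by (simp add: affine_map_def prod_eq_iff)
  then have fst_y: "fst y1 = fst z" "fst y2 = fst z"
    using S_corner_digit[of z] fe by (simp_all add: y1_def y2_def affine_map_def prod_eq_iff)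
  have "bar (snd (S e z)) = \<eta>"
    using bar_S(2)[OF eD, of z] bar_corner[OF z(1)] by (simp add: \<eta>_def)
  then have snd_y: "bar (snd y1) = n * \<eta>" "bar (snd y2) = n * \<eta> + \<eta>"
    using bar_S(2)[OF eD, of "S e z"] bar_S(2)[OF cD, of "S e z"]
    by (simp_all add: y1_def y2_def rel rc \<eta>_def)
  have y_orbit: "y1 \<in> orbit z" "y2 \<in> orbit z"
    using corner_in_orbit[OF z(2)] orbit_closed z(2) eL by (simp_all add: y1_def y2_def)
  have bounds: "bar (fst w) < m ^ q \<and> n ^ (q + p) * h \<le> bar (snd w) \<and> bar (snd w) < n ^ (q + p) * (h + 1)"
    if w: "w \<in> block y" and y: "fst y = fst z" "bar (snd y) = h" for w y h
  proof -
    have col: "0 \<le> bar (fst v) \<and> bar (fst v) < 1 \<and> n ^ p * h \<le> bar (snd v) \<and> bar (snd v) < n ^ p * (h + 1)"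
      if v: "v \<in> (expand (column z) ^^ p) {y}" for v
      using bar_expand_bounds[OF v column_digits, of 0 1 h "h + 1"] fst_expand_column[OF v]
        bar_corner[OF z(1)] y by auto
    show ?thesis
      using bar_expand_bounds[OF w[unfolded block_def] digits col] by (simp add: power_add mult.assoc)
  qed
  let ?l = "n ^ (q + p)"
  have l0: "?l > 0" using m_n_ge by simp
  have \<eta>n: "\<eta> + 1 \<le> n * \<eta>" "n * \<eta> \<ge> 1"
  proof -
    have "2 * \<eta> \<le> n * \<eta>" using two_le_n \<eta> by (intro mult_right_mono) auto
    then show "\<eta> + 1 \<le> n * \<eta>" "n * \<eta> \<ge> 1" using \<eta> by linarith+
  qed
  \<comment> \<open>The first bar on a block is below \<open>m ^ q\<close>, hence below
    \<open>?l\<close>; by this inequality the second bar decides the gauge.\<close>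
  have lG: "?l \<le> ?l * (n * \<eta>)" using \<eta>n l0 by simp
  have shell: "\<exists>k'. j + 2 \<le> k' \<and> k' \<le> j + 2 + shift \<and> (block y1 \<subseteq> shell k' \<or> block y2 \<subseteq> shell k')"
  proof (rule ex_single_shell[where G = "?l * (n * \<eta>)" and G' = "?l * (n * \<eta> + \<eta>)"])
    fix w assume "w \<in> block y1"
    from bounds[OF this fst_y(1) snd_y(1)]
    have b: "bar (fst w) < m ^ q" "?l * (n * \<eta>) \<le> bar (snd w)" "bar (snd w) < ?l * (n * \<eta> + 1)" by auto
    have "?l * (n * \<eta> + 1) \<le> ?l * (n * \<eta> + \<eta>)" using \<eta> l0 by simp
    with b l lG show "?l * (n * \<eta>) \<le> gauge w \<and> gauge w < ?l * (n * \<eta> + \<eta>)"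
      unfolding gauge_def by linarith
  next
    fix w assume "w \<in> block y2"
    from bounds[OF this fst_y(2) snd_y(2)]
    have b: "bar (fst w) < m ^ q" "?l * (n * \<eta> + \<eta>) \<le> bar (snd w)"
      "bar (snd w) < ?l * (n * \<eta> + \<eta> + 1)" by auto
    have "?l * (n * \<eta> + \<eta> + 1) \<le> ?l * (2 * (n * \<eta>))"
      using \<eta>n l0 by (intro mult_left_mono) linarith+
    with b l l0 lG show "?l * (n * \<eta> + \<eta>) \<le> gauge w \<and> gauge w < 2 * (?l * (n * \<eta>))"
      unfolding gauge_def by linarith
  next
    have "(2::int) ^ j \<le> 2 ^ Suc j" by (rule power_increasing) auto
    then show "2 ^ j \<le> ?l * (n * \<eta>)" using lG l(1) q(1) by linarith
    have "?l * (n * \<eta>) \<le> (n * m ^ q) * (n * n)"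
      using l(2) \<eta> m_n_ge by (intro mult_mono) auto
    also have "\<dots> \<le> (m * m ^ q) * (m * m)"
      using n_le_m m_n_ge by (intro mult_mono) auto
    also have "\<dots> \<le> (m * (m * 2 ^ Suc j)) * (m * m)"
      using q(2) m_n_ge by (intro mult_right_mono mult_left_mono) auto
    also have "\<dots> = 2 * m ^ 4 * 2 ^ j" by (simp add: power_numeral_reduce)
    finally have "2 * (?l * (n * \<eta>)) \<le> 4 * m ^ 4 * 2 ^ j" by linarith
    also have "\<dots> \<le> 4 * m ^ 5 * 2 ^ j"
      using m_n_ge by (intro mult_right_mono mult_left_mono power_increasing) auto
    also have "\<dots> \<le> 2 ^ shift * 2 ^ j" by (intro mult_right_mono shift_bound) simp
    finally show "2 * (?l * (n * \<eta>)) \<le> 2 ^ (j + shift)" by (simp add: power_add mult.commute)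
  qed
  then obtain k' y where k': "j + 2 \<le> k'" "k' \<le> j + 2 + shift" and y: "y \<in> {y1, y2}"
    and sub: "block y \<subseteq> shell k'" by blast
  have "block y \<subseteq> orbit z"
    unfolding block_def using y y_orbit by (intro expand_column_funpow_subset_orbit) auto
  moreover have "card (cell a b ` (orbit z' \<inter> shell (j + 2))) \<le> card (cell a b ` block y)"
    if z': "z' \<in> corners" "corner_digit z' \<in> \<Lambda>" "card (column z') \<le> card (column z)" for z' a b
  proof -
    have "orbit z' \<inter> shell (j + 2) \<subseteq> (expand \<Lambda> ^^ q) ((expand (column z') ^^ p) {z'})"
      using q l by (intro shell_part_subset z') auto
    then have "card (cell a b ` (orbit z' \<inter> shell (j + 2)))
        \<le> card (cell a b ` (expand \<Lambda> ^^ q) ((expand (column z') ^^ p) {z'}))"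
      by (intro card_mono image_mono finite_imageI finite_expand_funpow digits column_digits) simp
    \<comment> \<open>A single point occupies one cell at every level, so replacing the starting
      point z' by y does not affect the count. Only the columns are compared.\<close>
    also have "\<dots> \<le> card (cell a b ` block y)"
      unfolding block_def
      by (intro card_cells_funpow_mono digits column_digits card_truncate_column_le z z' order_refl) simp
    finally show ?thesis .
  qed
  ultimately show ?thesis
    using k' sub by (intro exI[of _ k'] exI[of _ "block y"] conjI allI impI Int_greatest) simp_all
qed

text \<open>A singleton column merely reproduces its corner, so a block consists of its q free
  letters alone, but no outward digit is left in the column. The push comes from the corner digit of
  v on the opposite side, and the first coordinate decides the gauge.\<close>

lemma ex_copy_singleton_column:
  assumes z: "z \<in> corners" "corner_digit z \<in> \<Lambda>" "card (column z) \<le> 1"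
    and v: "v \<in> corners" "corner_digit v \<in> \<Lambda>" "fst v \<noteq> fst z"
  shows "\<exists>k' Y. j + 2 \<le> k' \<and> k' \<le> j + 2 + shift \<and> Y \<subseteq> orbit z \<inter> shell k' \<and>
    (\<forall>z' a b. z' \<in> corners \<and> corner_digit z' \<in> \<Lambda> \<and> card (column z') \<le> card (column z) \<longrightarrow>
      card (cell a b ` (orbit z' \<inter> shell (j + 2))) \<le> card (cell a b ` Y))"
proof -
  let ?c = "corner_digit z" and ?e = "corner_digit v"
  obtain q p where q: "2 ^ Suc j < m ^ q" "m ^ q \<le> m * 2 ^ Suc j"
    and l: "m ^ q < n ^ (q + p)" by (rule ex_block_size)
  define block where "block = (\<lambda>y. (expand \<Lambda> ^^ q) {y})"
  have cD: "?c \<in> all_digits" and eD: "?e \<in> all_digits"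
    using corner_digit_range z v by blast+
  define \<upsilon> where "\<upsilon> = rel_digit n (snd z) (snd ?e)"
  have \<upsilon>: "0 \<le> \<upsilon>" "\<upsilon> \<le> n - 1"
    using rel_digit_range[of "snd ?e" n "snd z"] digitD[OF eD] by (auto simp: \<upsilon>_def)
  \<comment> \<open>Seen from z, the first digit of an opposite corner is the extreme one, which
    gives the largest possible push.\<close>
  have re: "rel_digit m (fst z) (fst ?e) = m - 1"
    using z(1) v(1,3) by (auto simp: rel_digit_def corners_def corner_digit_def)
  have rc: "rel_digit m (fst z) (fst ?c) = 0" "rel_digit n (snd z) (snd ?c) = 0"
    using z(1) by (auto simp: rel_digit_def corners_def corner_digit_def)
  have signs: "same_signs z (S ?e z)" using eD by (simp add: same_signs_S) (simp add: same_signs_def)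
  have rel: "rel_digit m (fst (S ?e z)) i = rel_digit m (fst z) i"
    "rel_digit n (snd (S ?e z)) i = rel_digit n (snd z) i" for i
    using signs by (simp_all add: same_signs_def rel_digit_def)
  define y1 where "y1 = S ?c (S ?e z)"
  define y2 where "y2 = S ?e (S ?e z)"
  have "bar (fst (S ?e z)) = m - 1" "bar (snd (S ?e z)) = \<upsilon>"
    using bar_S[OF eD, of z] bar_corner[OF z(1)] re by (simp_all add: \<upsilon>_def)
  then have bar_y: "bar (fst y1) = m * (m - 1)" "bar (snd y1) = n * \<upsilon>"
    "bar (fst y2) = m * (m - 1) + (m - 1)" "bar (snd y2) = n * \<upsilon> + \<upsilon>"
    using bar_S[OF eD, of "S ?e z"] bar_S[OF cD, of "S ?e z"]
    by (simp_all add: y1_def y2_def rel rc re \<upsilon>_def)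
  have y_orbit: "y1 \<in> orbit z" "y2 \<in> orbit z"
    using corner_in_orbit[OF z(2)] orbit_closed z(2) v(2) by (simp_all add: y1_def y2_def)
  have gauge_bounds: "m ^ q * h \<le> gauge w \<and> gauge w < m ^ q * (h + 1)"
    if w: "w \<in> block y" and y: "bar (fst y) = h" "bar (snd y) \<le> h" for w y h
  proof -
    have "0 \<le> h" using y bar_nonneg[of "fst y"] by simp
    have "m ^ q * h \<le> bar (fst w)" "bar (fst w) < m ^ q * (h + 1)" "bar (snd w) < n ^ q * (h + 1)"
      using bar_expand_bounds[OF w[unfolded block_def] digits, of h "h + 1" 0 "h + 1"] y
      by (auto simp: bar_nonneg)
    moreover have "n ^ q * (h + 1) \<le> m ^ q * (h + 1)"
      using \<open>0 \<le> h\<close> n_le_m m_n_ge by (intro mult_right_mono power_mono) auto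
    ultimately show ?thesis unfolding gauge_def by linarith
  qed
  have m0: "m ^ q > 0" using m_n_ge by simp
  have mm: "m * (m - 1) \<ge> m" using m_n_ge by simp
  \<comment> \<open>The second bar may grow along with the first; \<open>n \<le> m\<close> keeps it
    no larger.\<close>
  have le1: "n * \<upsilon> \<le> m * (m - 1)"
    using \<upsilon> n_le_m m_n_ge by (intro mult_mono) auto
  have shell: "\<exists>k'. j + 2 \<le> k' \<and> k' \<le> j + 2 + shift \<and> (block y1 \<subseteq> shell k' \<or> block y2 \<subseteq> shell k')"
  proof (rule ex_single_shell[where G = "m ^ q * (m * (m - 1))"
        and G' = "m ^ q * (m * (m - 1) + (m - 1))"])
    fix w assume "w \<in> block y1"
    from gauge_bounds[OF this bar_y(1)] le1 bar_y
    have "m ^ q * (m * (m - 1)) \<le> gauge w" "gauge w < m ^ q * (m * (m - 1) + 1)" by auto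
    moreover have "m ^ q * (m * (m - 1) + 1) \<le> m ^ q * (m * (m - 1) + (m - 1))"
      using m0 m_n_ge by (intro mult_left_mono) auto
    ultimately show "m ^ q * (m * (m - 1)) \<le> gauge w \<and> gauge w < m ^ q * (m * (m - 1) + (m - 1))"
      by linarith
  next
    fix w assume "w \<in> block y2"
    from gauge_bounds[OF this bar_y(3)] le1 bar_y \<upsilon> n_le_m
    have "m ^ q * (m * (m - 1) + (m - 1)) \<le> gauge w" "gauge w < m ^ q * (m * (m - 1) + (m - 1) + 1)"
      by auto
    moreover have "m ^ q * (m * (m - 1) + (m - 1) + 1) \<le> m ^ q * (2 * (m * (m - 1)))"
      using m0 mm by (intro mult_left_mono) auto
    ultimately show "m ^ q * (m * (m - 1) + (m - 1)) \<le> gauge w \<and> gauge w < 2 * (m ^ q * (m * (m - 1)))"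
      by linarith
  next
    have "m ^ q * 1 \<le> m ^ q * (m * (m - 1))" using mm m0 m_n_ge by (intro mult_left_mono) linarith+
    moreover have "(2::int) ^ j \<le> 2 ^ Suc j" by (rule power_increasing) auto
    ultimately show "2 ^ j \<le> m ^ q * (m * (m - 1))" using q(1) by linarith
    have "m ^ q * (m * (m - 1)) \<le> (m * 2 ^ Suc j) * (m * m)"
      using q(2) m_n_ge by (intro mult_mono) auto
    also have "\<dots> = 2 * m ^ 3 * 2 ^ j" by (simp add: power_numeral_reduce)
    finally have "2 * (m ^ q * (m * (m - 1))) \<le> 4 * m ^ 3 * 2 ^ j" by linarith
    also have "\<dots> \<le> 4 * m ^ 5 * 2 ^ j"
      using m_n_ge by (intro mult_right_mono mult_left_mono power_increasing) auto
    also have "\<dots> \<le> 2 ^ shift * 2 ^ j" by (intro mult_right_mono shift_bound) simp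
    finally show "2 * (m ^ q * (m * (m - 1))) \<le> 2 ^ (j + shift)" by (simp add: power_add mult.commute)
  qed
  then obtain k' y where k': "j + 2 \<le> k'" "k' \<le> j + 2 + shift" and y: "y \<in> {y1, y2}"
    and sub: "block y \<subseteq> shell k'" by blast
  have "{y} \<subseteq> orbit z" using y y_orbit by blast
  from expand_column_funpow_subset_orbit[OF this, where p = 0 and q = q]
  have "block y \<subseteq> orbit z" unfolding block_def by (simp only: funpow_0)
  moreover have "card (cell a b ` (orbit z' \<inter> shell (j + 2))) \<le> card (cell a b ` block y)"
    if z': "z' \<in> corners" "corner_digit z' \<in> \<Lambda>" "card (column z') \<le> card (column z)" for z' a b
  proof -
    \<comment> \<open>A competing z' has a column no larger than that of z, hence a singleton, and
      its column block collapses to z' itself.\<close>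
    have "card (column z') \<le> Suc 0" using z'(3) z(3) by simp
    then have "column z' = {corner_digit z'}"
      using corner_digit_in_column[OF z'(2)] card_le_Suc0_iff_eq[OF finite_column, of z'] by blast
    then have step: "expand (column z') {z'} = {z'}"
      by (simp only: expand_def S_corner_digit image_insert image_empty UN_insert UN_empty Un_empty_right Union_insert Union_empty)
    have fixed: "(expand (column z') ^^ p) {z'} = {z'}"
      by (induction p) (simp_all add: step)
    have "orbit z' \<inter> shell (j + 2) \<subseteq> (expand \<Lambda> ^^ q) ((expand (column z') ^^ p) {z'})"
      using q l by (intro shell_part_subset z') auto
    then have "card (cell a b ` (orbit z' \<inter> shell (j + 2))) \<le> card (cell a b ` (expand \<Lambda> ^^ q) {z'})"
      unfolding fixed by (intro card_mono image_mono finite_imageI finite_expand_funpow digits) simp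
    also have "\<dots> \<le> card (cell a b ` block y)"
      unfolding block_def by (intro card_cells_funpow_mono digits order_refl) simp
    finally show ?thesis .
  qed
  ultimately show ?thesis
    using k' sub by (intro exI[of _ k'] exI[of _ "block y"] conjI allI impI Int_greatest) simp_all
qed

text \<open>The winner is the corner with the largest column. In the constant of the comparison,
  \<open>card P\<close> counts the orbits, 4 the parity classes of cells, and \<open>m * n\<close>
  pays for rounding the scale.\<close>

lemma lower_entropy_index_orbits:
  assumes P: "P \<subseteq> corners" "P \<noteq> {}" "\<And>z. z \<in> P \<Longrightarrow> corner_digit z \<in> \<Lambda>"
  shows "\<exists>z\<in>P. lower_entropy_index (\<Union>v\<in>P. orbit v) \<le> lower_entropy_index (orbit z)"
proof (cases "\<exists>z. P = {z}")
  \<comment> \<open>With one corner the union is a single orbit. This case is separated because that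
    orbit may be the point z alone, with no copy in any outer shell.\<close>
  case True
  then show ?thesis by auto
next
  case False
  have finP: "finite P" using P(1) finite_corners by (rule finite_subset)
  have "Max ((card \<circ> column) ` P) \<in> (card \<circ> column) ` P" using finP P by (intro Max_in) auto
  then obtain z where z: "z \<in> P" and "card (column z) = Max ((card \<circ> column) ` P)" by auto
  then have maxz: "card (column v) \<le> card (column z)" if "v \<in> P" for v
    using that finP by simp
  obtain v where v: "v \<in> P" "v \<noteq> z" using False z by blast
  have zc: "z \<in> corners" "corner_digit z \<in> \<Lambda>" and vc: "v \<in> corners" "corner_digit v \<in> \<Lambda>"
    using P z v by auto
  have copy: "\<exists>k' Y. j + 2 \<le> k' \<and> k' \<le> j + 2 + shift \<and> Y \<subseteq> orbit z \<inter> shell k' \<and>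
    (\<forall>z' a b. z' \<in> corners \<and> corner_digit z' \<in> \<Lambda> \<and> card (column z') \<le> card (column z) \<longrightarrow>
      card (cell a b ` (orbit z' \<inter> shell (j + 2))) \<le> card (cell a b ` Y))" for j
  proof (cases "card (column z) \<le> 1")
    case True
    \<comment> \<open>Two corners on the same vertical line would both put their corner digits into
      the column of z.\<close>
    have "fst v \<noteq> fst z"
    proof
      assume "fst v = fst z"
      then have "corner_digit v \<in> column z"
        using vc by (simp add: column_def corner_digit_def)
      then have "corner_digit v = corner_digit z"
        using True corner_digit_in_column[OF zc(2)] card_le_Suc0_iff_eq[OF finite_column, of z] by auto
      with v(2) show False using corner_digit_inj by blast
    qed
    with zc True vc show ?thesis by (rule ex_copy_singleton_column)
  next
    case False
    then obtain e where "e \<in> column z" "e \<noteq> corner_digit z"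
      using card_le_Suc0_iff_eq[OF finite_column, of z] by (metis One_nat_def)
    with zc show ?thesis by (rule ex_copy_column)
  qed
  then obtain \<kappa> Y where \<kappa>: "\<And>j. j + 2 \<le> \<kappa> j" "\<And>j. \<kappa> j \<le> j + 2 + shift"
    and Y: "\<And>j. Y j \<subseteq> orbit z \<inter> shell (\<kappa> j)"
    and cells: "\<And>j z' a b. z' \<in> corners \<Longrightarrow> corner_digit z' \<in> \<Lambda> \<Longrightarrow> card (column z') \<le> card (column z)
      \<Longrightarrow> card (cell a b ` (orbit z' \<inter> shell (j + 2))) \<le> card (cell a b ` Y j)"
    by metis
  let ?U = "\<Union>v\<in>P. orbit v"
  have cells_le: "card (cell a b ` (?U \<inter> shell (j + 2)))
      \<le> card P * card (cell a b ` (orbit z \<inter> shell (\<kappa> j)))" for a b j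
  proof -
    have "cell a b ` (?U \<inter> shell (j + 2)) = (\<Union>v\<in>P. cell a b ` (orbit v \<inter> shell (j + 2)))" by blast
    then have "card (cell a b ` (?U \<inter> shell (j + 2)))
        = card (\<Union>v\<in>P. cell a b ` (orbit v \<inter> shell (j + 2)))" by (rule arg_cong)
    also have "\<dots> \<le> (\<Sum>v\<in>P. card (cell a b ` (orbit v \<inter> shell (j + 2))))"
      using finP by (rule card_UN_le)
    also have "\<dots> \<le> (\<Sum>v\<in>P. card (cell a b ` (orbit z \<inter> shell (\<kappa> j))))"
    proof (rule sum_mono)
      fix v assume v: "v \<in> P"
      have "card (cell a b ` (orbit v \<inter> shell (j + 2))) \<le> card (cell a b ` Y j)"
        using v P maxz by (intro cells) auto
      also have "\<dots> \<le> card (cell a b ` (orbit z \<inter> shell (\<kappa> j)))"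
        by (intro card_mono image_mono Y finite_imageI finite_Int disjI2 finite_shell)
      finally show "card (cell a b ` (orbit v \<inter> shell (j + 2)))
        \<le> card (cell a b ` (orbit z \<inter> shell (\<kappa> j)))" .
    qed
    finally show ?thesis by simp
  qed
  have pack: "real (packing_number r (?U \<inter> shell (j + 2)))
      \<le> real (nat (m * n) * (card P * 4)) * real (packing_number r (orbit z \<inter> shell (\<kappa> j)))"
    if r: "1 \<le> r" for r j
  proof -
    have fin: "finite (A \<inter> shell k)" for A k using finite_shell by blast
    \<comment> \<open>Cells of level (a, b) have sides at most r and bound packings from above;
      those of level (Suc a, Suc b) have sides larger than r and bound packings from below.\<close>
    obtain a where a: "real_of_int m ^ a \<le> r" "r < real_of_int m ^ Suc a"
      using ex_power_bracket[of "real_of_int m" r] m_n_ge r by auto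
    obtain b where b: "real_of_int n ^ b \<le> r" "r < real_of_int n ^ Suc b"
      using ex_power_bracket[of "real_of_int n" r] m_n_ge r by auto
    have "packing_number r (?U \<inter> shell (j + 2)) \<le> card (cell a b ` (?U \<inter> shell (j + 2)))"
      using a b by (intro packing_number_le_cells fin) auto
    also have "\<dots> \<le> nat (m * n) * card (cell (Suc a) (Suc b) ` (?U \<inter> shell (j + 2)))"
      by (intro card_cells_refine fin)
    also have "\<dots> \<le> nat (m * n) * (card P * card (cell (Suc a) (Suc b) ` (orbit z \<inter> shell (\<kappa> j))))"
      by (intro mult_left_mono cells_le) simp
    also have "\<dots> \<le> nat (m * n) * (card P * (4 * packing_number r (orbit z \<inter> shell (\<kappa> j))))"
      using a b by (intro mult_left_mono cells_le_packing_number fin) auto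
    finally show ?thesis unfolding of_nat_mult[symmetric] of_nat_le_iff by (simp only: mult_ac)
  qed
  have "lower_entropy_index ?U \<le> lower_entropy_index (orbit z)"
  proof (rule lower_entropy_index_le[where \<kappa> = "\<lambda>k. \<kappa> (k - 2)" and ?k0.0 = 2 and c = shift])
    fix k :: nat assume k: "k \<ge> 2"
    then have "k - 2 + 2 = k" by simp
    then show "k \<le> \<kappa> (k - 2) \<and> \<kappa> (k - 2) \<le> k + shift" using \<kappa>[of "k - 2"] by simp
  next
    fix k :: nat and r :: real assume k: "k \<ge> 2" and r: "1 \<le> r"
    then have "k - 2 + 2 = k" by simp
    then show "real (packing_number r (?U \<inter> shell k))
      \<le> real (nat (m * n) * (card P * 4)) * real (packing_number r (orbit z \<inter> shell (\<kappa> (k - 2))))"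
      using pack[OF r, of "k - 2"] by simp
  qed simp
  with z show ?thesis by blast
qed

section \<open>Invariant sets\<close>

text \<open>The digit d is the residue of \<open>S d x\<close> modulo (m, n), so different digits
  send the whole lattice to disjoint sets.\<close>

lemma non_overlapping_affine_maps: "non_overlapping m n \<Lambda> K"
proof -
  have "d = d'" if "d \<in> \<Lambda>" "d' \<in> \<Lambda>" and eq: "S d x = S d' y" for d d' x y
  proof -
    have D: "d \<in> all_digits" "d' \<in> all_digits" using that digits by blast+
    have "m * fst x + fst d = m * fst y + fst d'" "n * snd x + snd d = n * snd y + snd d'"
      using eq by (simp_all add: affine_map_def)
    from digit_unique[OF this(1)] digit_unique[OF this(2)] digitD[OF D(1)] digitD[OF D(2)]
    show ?thesis by (simp add: prod_eq_iff)
  qed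
  then show ?thesis unfolding non_overlapping_def by blast
qed

context
  fixes K assumes inv: "invariant_set m n \<Lambda> K"
begin

text \<open>A preimage of a corner has both bars below 1 and the same signs, so it is that corner
  again. The map leading back fixes the corner and must carry its corner digit.\<close>

lemma corner_digit_of_invariant:
  assumes "z \<in> K \<inter> corners"
  shows "corner_digit z \<in> \<Lambda>"
proof -
  obtain d w where d: "d \<in> \<Lambda>" and w: "w \<in> K" "z = S d w"
    using invariantE[OF inv, of z] assms by blast
  then have D: "d \<in> all_digits" using digits by blast
  have "bar (fst z) < m ^ Suc 0" "bar (snd z) < n ^ Suc 0"
    using assms bar_corner[of z] m_n_ge by auto
  then have "bar (fst w) < 1" "bar (snd w) < 1"
    using bar_S_less[OF D, of w 0] w(2) by simp_all
  moreover have "same_signs z w"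
    using same_signs_S[OF D, of z w] w(2) by (simp add: same_signs_def)
  ultimately have "w = z" using assms corner_eqI by blast
  with w(2) have "d = corner_digit z" using fixed_digit_eq by simp
  with d show ?thesis by simp
qed

lemma invariant_eq_Union_orbits: "K = (\<Union>z\<in>K \<inter> corners. orbit z)"
proof (intro equalityI subsetI)
  fix w assume w: "w \<in> K"
  have descend: "w \<in> (\<Union>z\<in>K \<inter> corners. orbit z)"
    if "w \<in> K" "bar (fst w) < m ^ q" "bar (snd w) < n ^ q" for w q
    using that
  proof (induction q arbitrary: w)
    case 0
    then have "w \<in> K \<inter> corners" by (cases w) (auto simp: corners_def bar_def split: if_splits)
    then show ?case using corner_digit_of_invariant corner_in_orbit by blast
  next
    case (Suc q)
    obtain d v where d: "d \<in> \<Lambda>" and v: "v \<in> K" "w = S d v"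
      using invariantE[OF inv Suc.prems(1)] .
    then have D: "d \<in> all_digits" using digits by blast
    have "v \<in> (\<Union>z\<in>K \<inter> corners. orbit z)"
      using Suc.prems v bar_S_less[OF D] by (intro Suc.IH) auto
    then show ?case using d v(2) orbit_closed by blast
  qed
  \<comment> \<open>One exponent for both coordinates; since \<open>x < b ^ nat x\<close> for
    \<open>b \<ge> 2\<close>, it is found without logarithms.\<close>
  let ?q = "max (nat (bar (fst w))) (nat (bar (snd w)))"
  have "bar (fst w) < m ^ nat (bar (fst w))" "bar (snd w) < n ^ nat (bar (snd w))"
    using m_n_ge two_le_n by (auto intro: int_less_power)
  moreover have "m ^ nat (bar (fst w)) \<le> m ^ ?q" "n ^ nat (bar (snd w)) \<le> n ^ ?q"
    using m_n_ge by (auto intro!: power_increasing)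
  ultimately have "bar (fst w) < m ^ ?q" "bar (snd w) < n ^ ?q" by linarith+
  with w show "w \<in> (\<Union>z\<in>K \<inter> corners. orbit z)" by (rule descend)
next
  fix w assume "w \<in> (\<Union>z\<in>K \<inter> corners. orbit z)"
  then show "w \<in> K" using orbit_subset[of _ K] invariant_closed[OF inv] by blast
qed

end

end

text \<open>Finiteness of P' makes \<open>MAX\<close> a genuine maximum, and the equalities of
  \<open>dim_LM\<close> and \<open>dim_UM\<close> ensure that \<open>dim_M\<close> is a limit rather
  than \<open>undefined\<close>.\<close>

theorem proposition8p5:
  fixes m n :: int and \<Lambda> K :: "(int \<times> int) set"
  assumes "m \<ge> n" and "n \<ge> 2"
    and "\<Lambda> \<subseteq> {0..m - 1} \<times> {0..n - 1}" and "\<Lambda> \<noteq> {}"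
    and "invariant_set m n \<Lambda> K"
  shows "non_overlapping m n \<Lambda> K \<and>
    (\<exists>P'. P' \<noteq> {} \<and> P' \<subseteq> periodic_points m n \<Lambda> \<and>
      K = (\<Union>z\<in>P'. forward_orbit m n \<Lambda> z) \<and>
      finite P' \<and>
      dim_LM K = dim_UM K \<and>
      (\<forall>z\<in>P'. dim_LM (forward_orbit m n \<Lambda> z) = dim_UM (forward_orbit m n \<Lambda> z)) \<and>
      (\<forall>Dim \<in> {dim_LH, dim_DH, lower_entropy_index, dim_M, dim_DP, dim_Be, dim_A}.
         Dim K = (MAX z\<in>P'. Dim (forward_orbit m n \<Lambda> z))))"
proof -
  interpret digit_maps m n \<Lambda> using assms by unfold_locales
  define P where "P = K \<inter> corners"
  have K: "K = (\<Union>z\<in>P. orbit z)" unfolding P_def by (rule invariant_eq_Union_orbits[OF assms(5)])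
  have "K \<noteq> {}" using assms(5) by (simp add: invariant_set_def)
  with K have P_ne: "P \<noteq> {}" by blast
  have fin: "finite P" unfolding P_def using finite_corners by blast
  have P_digits: "corner_digit z \<in> \<Lambda>" "z \<in> corners" if "z \<in> P" for z
    using that corner_digit_of_invariant[OF assms(5)] by (auto simp: P_def)
  have "\<forall>z\<in>P. \<exists>L. has_mass_dim (orbit z) L" using has_mass_dim_orbit P_digits by blast
  then obtain L where L: "\<And>z. z \<in> P \<Longrightarrow> has_mass_dim (orbit z) (L z)" by metis
  have KL: "has_mass_dim K (MAX z\<in>P. L z)"
    unfolding K using fin P_ne L by (rule has_mass_dim_UNION)
  have "dim_M K = (MAX z\<in>P. dim_M (orbit z))"
  proof -
    have "(MAX z\<in>P. dim_M (orbit z)) = (MAX z\<in>P. ereal (L z))"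
      using has_mass_dimD(3)[OF L] by (intro arg_cong[where f = Max] image_cong) auto
    also have "\<dots> = ereal (MAX z\<in>P. L z)"
      using mono_Max_commute[of ereal "L ` P"] fin P_ne by (simp add: mono_def image_image)
    finally show ?thesis using has_mass_dimD(3)[OF KL] by simp
  qed
  moreover have "lower_entropy_index K = (MAX z\<in>P. lower_entropy_index (orbit z))"
  proof (rule antisym)
    obtain z where z: "z \<in> P" "lower_entropy_index K \<le> lower_entropy_index (orbit z)"
      unfolding K using lower_entropy_index_orbits[of P] P_digits P_ne by blast
    note z(2)
    also have "lower_entropy_index (orbit z) \<le> (MAX z\<in>P. lower_entropy_index (orbit z))"
      using z(1) fin by (intro Max_ge) auto
    finally show "lower_entropy_index K \<le> (MAX z\<in>P. lower_entropy_index (orbit z))" .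
    show "(MAX z\<in>P. lower_entropy_index (orbit z)) \<le> lower_entropy_index K"
      using fin P_ne K by (auto intro!: lower_entropy_index_mono)
  qed
  moreover have "Dim K = (MAX z\<in>P. Dim (orbit z))" if "Dim \<in> {dim_LH, dim_DH, dim_DP, dim_Be, dim_A}" for Dim
    unfolding K using that fin P_ne
    by (intro Max_image_finite_union) (auto simp: dim_LH_Un dim_DH_Un dim_DP_Un dim_Be_Un dim_A_Un)
  ultimately have "\<forall>Dim \<in> {dim_LH, dim_DH, lower_entropy_index, dim_M, dim_DP, dim_Be, dim_A}.
      Dim K = (MAX z\<in>P. Dim (orbit z))"
    by blast
  moreover have "P \<subseteq> periodic_points m n \<Lambda>" using P_digits corner_periodic by blast
  moreover have "dim_LM K = dim_UM K" using has_mass_dimD(1,2)[OF KL] by simp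
  moreover have "\<forall>z\<in>P. dim_LM (orbit z) = dim_UM (orbit z)"
    using has_mass_dimD(1,2)[OF L] by simp
  ultimately show ?thesis
    using P_ne K fin non_overlapping_affine_maps[of K] by (intro conjI exI[of _ P])
qed

end
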